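(* Let $a=(a_e)_{e\in E}$ be arbitrary real constants, and for an integer $k\ge0$ let $$W(\sigma)=\sum_{e\in E}a_eH_k(g_e)f_e(\sigma).$$ Then for $k\geq0$, $$\mathbb{E}\bigl(\langle W(\sigma)^2\rangle-\langle W(\sigma)\rangle^2\bigr)\leq\frac{\sqrt{k!\,(k+1)!}}{\gamma}\|a\|_1\|a\|_2,$$ and for $k\geq1$, $$\mathbb{E}\bigl(\langle W(\sigma)^2\rangle-\langle W(\sigma)\rangle^2\bigr)\leq C_k\sqrt{(k+1)!}\,\gamma^{k-1}\|a\|_1\|a\|_2+k!\,\|a\|_2^2,$$ where $C_k$ is any constant such that, with probability one, $|F_e^{(k)}|\leq C_k$ for all $e\in E$, with $$F_e^{(k)}=\frac{1}{\gamma^k}\frac{\partial^k}{\partial g_e^k}\langle f_e(\sigma)\rangle.$$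
   Context: Let $(\Sigma,\mathcal{F})$ be a measurable space, $E$ a fixed finite index set, $(f_e)_{e\in E}$ a family of measurable functions $f_e:\Sigma\to[-1,1]$, and $(g_e)_{e\in E}$ i.i.d. standard Gaussian random variables. Let $$Y(\sigma)=\sum_{e\in E}g_ef_e(\sigma),\qquad dG(\sigma)=\frac{\exp(\gamma Y(\sigma))}{Z}\,d\mu(\sigma),$$ where $\gamma>0$ is a constant, $\mu$ is a (possibly random) finite nonzero measure on $(\Sigma,\mathcal{F})$, and $Z$ is the normalizing constant making the Gibbs measure $G$ a probability measure. The functions $f_e$ may also be random; all the randomness of $(f_e)_{e\in E}$ and $\mu$ is independent of $(g_e)_{e\in E}$. The bracket $\langle\,\cdot\,\rangle$ denotes the average with respect to $G$ (for fixed disorder, including the $g_e$), and $\mathbb{E}$ the expectation over all the disorder. In $F_e^{(k)}$, the quantity $\langle f_e(\sigma)\rangle$ is viewed as a smooth function of the variables $(g_{e'})_{e'\in E}$ (with $\mu$ and the $f_{e'}$ fixed) and differentiated $k$ times in $g_e$. The Hermite polynomials are $$H_k(x)=(-1)^ke^{x^2/2}\frac{d^k}{dx^k}e^{-x^2/2}.$$ Notation: $\|a\|_2=(\sum_{e\in E}a_e^2)^{1/2}$ and $\|a\|_1=\sum_{e\in E}|a_e|$. *)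

theory Defs
  imports "HOL-Probability.Probability"
begin

definition hermite :: "nat \<Rightarrow> real \<Rightarrow> real" where
  "hermite k x = (-1) ^ k * exp (x\<^sup>2 / 2) * (deriv ^^ k) (\<lambda>t. exp (- t\<^sup>2 / 2)) x"

text \<open>
  The following notions are for one realization of the disorder: the functions
  \<open>f e\<close>, the reference measure \<open>\<mu>\<close>, and the values \<open>y e\<close> of the Gaussian
  coefficients. The sums range over the finite index set \<open>E\<close>, so
  values of \<open>f\<close> and \<open>y\<close> outside \<open>E\<close> are irrelevant.
\<close>

definition energy :: "'e set \<Rightarrow> ('e \<Rightarrow> 's \<Rightarrow> real) \<Rightarrow> ('e \<Rightarrow> real) \<Rightarrow> 's \<Rightarrow> real" where
  "energy E f y \<sigma> = (\<Sum>e\<in>E. y e * f e \<sigma>)"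

definition partition_fun ::
    "real \<Rightarrow> 'e set \<Rightarrow> ('e \<Rightarrow> 's \<Rightarrow> real) \<Rightarrow> 's measure \<Rightarrow> ('e \<Rightarrow> real) \<Rightarrow> real" where
  "partition_fun \<gamma> E f \<mu> y = (\<integral>\<sigma>. exp (\<gamma> * energy E f y \<sigma>) \<partial>\<mu>)"

definition gibbs ::
    "real \<Rightarrow> 'e set \<Rightarrow> ('e \<Rightarrow> 's \<Rightarrow> real) \<Rightarrow> 's measure \<Rightarrow> ('e \<Rightarrow> real) \<Rightarrow> 's measure" where
  "gibbs \<gamma> E f \<mu> y =
     density \<mu> (\<lambda>\<sigma>. ennreal (exp (\<gamma> * energy E f y \<sigma>) / partition_fun \<gamma> E f \<mu> y))"

definition gibbs_avg ::
    "real \<Rightarrow> 'e set \<Rightarrow> ('e \<Rightarrow> 's \<Rightarrow> real) \<Rightarrow> 's measure \<Rightarrow> ('e \<Rightarrow> real) \<Rightarrow> ('s \<Rightarrow> real) \<Rightarrow> real" where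
  "gibbs_avg \<gamma> E f \<mu> y h = (\<integral>\<sigma>. h \<sigma> \<partial>gibbs \<gamma> E f \<mu> y)"

definition gibbs_var ::
    "real \<Rightarrow> 'e set \<Rightarrow> ('e \<Rightarrow> 's \<Rightarrow> real) \<Rightarrow> 's measure \<Rightarrow> ('e \<Rightarrow> real) \<Rightarrow> ('s \<Rightarrow> real) \<Rightarrow> real" where
  "gibbs_var \<gamma> E f \<mu> y h =
     gibbs_avg \<gamma> E f \<mu> y (\<lambda>\<sigma>. (h \<sigma>)\<^sup>2) - (gibbs_avg \<gamma> E f \<mu> y h)\<^sup>2"

definition hermite_energy ::
    "'e set \<Rightarrow> ('e \<Rightarrow> real) \<Rightarrow> nat \<Rightarrow> ('e \<Rightarrow> 's \<Rightarrow> real) \<Rightarrow> ('e \<Rightarrow> real) \<Rightarrow> 's \<Rightarrow> real" where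
  "hermite_energy E a k f y \<sigma> = (\<Sum>e\<in>E. a e * hermite k (y e) * f e \<sigma>)"

text \<open>
  The scaled \<open>k\<close>-th partial derivative in the coordinate \<open>e\<close> of the Gibbs average of
  \<open>f e\<close>, with \<open>f\<close>, \<open>\<mu>\<close> and the other coordinates of \<open>y\<close> held fixed.
\<close>

definition gibbs_deriv ::
    "real \<Rightarrow> 'e set \<Rightarrow> ('e \<Rightarrow> 's \<Rightarrow> real) \<Rightarrow> 's measure \<Rightarrow> nat \<Rightarrow> 'e \<Rightarrow> ('e \<Rightarrow> real) \<Rightarrow> real" where
  "gibbs_deriv \<gamma> E f \<mu> k e y =
     1 / \<gamma> ^ k * (deriv ^^ k) (\<lambda>t. gibbs_avg \<gamma> E f \<mu> (y(e := t)) (f e)) (y e)"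

text \<open>
  A random finite nonzero measure on \<open>S\<close>, depending measurably on \<open>\<omega>\<close> in \<open>H\<close>.
\<close>

definition random_finite_measure :: "'w measure \<Rightarrow> 's measure \<Rightarrow> ('w \<Rightarrow> 's measure) \<Rightarrow> bool" where
  "random_finite_measure H S \<mu> \<longleftrightarrow>
     (\<forall>\<omega>\<in>space H. finite_measure (\<mu> \<omega>) \<and> sets (\<mu> \<omega>) = sets S \<and> emeasure (\<mu> \<omega>) (space S) \<noteq> 0) \<and>
     (\<forall>A\<in>sets S. (\<lambda>\<omega>. emeasure (\<mu> \<omega>) A) \<in> borel_measurable H)"

end

theory Submission
  imports Defs
begin

text \<open>
  Since \<open>\<partial>\<langle>f e'\<rangle>/\<partial>g e = \<gamma> Cov(f e, f e')\<close>, the expected Gibbs variance of \<open>W\<close> is \<open>1/\<gamma>\<close> times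
  \<open>\<Sum> a e a e' E [H k (g e) H k (g e') \<partial>\<langle>f e'\<rangle>/\<partial>g e]\<close>. Gaussian integration by parts raises
  \<open>H k (g e)\<close> to \<open>H (k + 1) (g e)\<close>; on the diagonal this only gives an inequality, because the extra
  terms have a sign by monotonicity of \<open>\<langle>f e\<rangle>\<close> in \<open>g e\<close>. Cauchy-Schwarz and the orthogonality of the
  Hermite polynomials give the first bound. For the second bound the diagonal is estimated directly
  by \<open>k!\<close>, and off the diagonal \<open>k\<close> further integrations by parts in \<open>g e'\<close> turn
  \<open>H k (g e') \<langle>f e'\<rangle>\<close> into the \<open>k\<close>-th derivative of \<open>\<langle>f e'\<rangle>\<close>.
  All of this is done for fixed \<open>f\<close> and \<open>\<mu>\<close>; independence and Fubini reduce the theorem to that case.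
\<close>

section \<open>Hermite polynomials and Gaussian integration by parts\<close>

text \<open>The product of the two norms comes from the order of summation. For fixed
  \<open>e'\<close> the sum X of \<open>a e * he (Suc k) (g e)\<close> over \<open>e\<close> is kept
  as one random variable: by orthogonality its second moment is \<open>fact (Suc k)\<close> times
  the squared 2-norm. Only the outer sum over \<open>e'\<close> is estimated term by term, which
  costs the 1-norm; applying Cauchy-Schwarz to each pair would give the squared 1-norm. In the
  second bound X omits the index \<open>e'\<close>, because the repeated integration by parts in
  \<open>g e'\<close> needs the other factor to be free of \<open>g e'\<close>. Integration by parts
  is stated for the operator q -> x q - q', the adjoint of differentiation under the Gaussian law.
  It sends H_k to H_(k+1); applied to H_k^2 it gives the diagonal identity, and applied to H_k
  H_(k+1) the normalization of the Hermite polynomials. The technical obstacle is measurability: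
  Fubini needs Gibbs averages and their iterated derivatives to be jointly measurable in \<omega>
  and \<open>y\<close>, although \<mu> is itself random and \<open>deriv\<close> is defined by
  choice.\<close>

fun hermite_poly :: "nat \<Rightarrow> real poly" where
  "hermite_poly 0 = 1"
| "hermite_poly (Suc k) = [:0, 1:] * hermite_poly k - pderiv (hermite_poly k)"

declare hermite_poly.simps(2) [simp del]

abbreviation he :: "nat \<Rightarrow> real \<Rightarrow> real" where
  "he k \<equiv> poly (hermite_poly k)"

text \<open>Differentiating the recursion yields H_(k+1) plus the recursion operator applied to
  H_(k+1)'. By induction H_(k+1)' is (k+1) H_k, and the operator turns this into (k+1)
  H_(k+1).\<close>

lemma pderiv_hermite_poly_Suc:
  "pderiv (hermite_poly (Suc k)) = smult (real (Suc k)) (hermite_poly k)"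
proof (induction k)
  case 0
  show ?case by (simp add: hermite_poly.simps pderiv_pCons pderiv_diff pderiv_mult one_pCons)
next
  case (Suc k)
  have "pderiv (hermite_poly (Suc (Suc k)))
      = hermite_poly (Suc k) + [:0, 1:] * pderiv (hermite_poly (Suc k))
        - pderiv (pderiv (hermite_poly (Suc k)))"
    by (simp add: hermite_poly.simps(2)[of "Suc k"] pderiv_diff pderiv_mult pderiv_pCons del: mult_pCons_left)
  also have "\<dots> = hermite_poly (Suc k) + smult (real (Suc k))
      ([:0, 1:] * hermite_poly k - pderiv (hermite_poly k))"
    unfolding Suc.IH by (simp add: pderiv_smult smult_diff_right)
  also have "\<dots> = hermite_poly (Suc k) + smult (real (Suc k)) (hermite_poly (Suc k))"
    by (simp only: hermite_poly.simps)
  also have "\<dots> = smult (real (Suc (Suc k))) (hermite_poly (Suc k))"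
    by (simp only: of_nat_Suc[of "Suc k"] smult_add_left smult_1_left)
  finally show ?case .
qed

text \<open>For \<open>k = 0\<close> the truncated \<open>k - 1\<close> is harmless, since the
  factor \<open>real k\<close> vanishes; the later computations thus avoid a case
  distinction.\<close>

lemma poly_pderiv_hermite_poly:
  "poly (pderiv (hermite_poly k)) x = real k * poly (hermite_poly (k - 1)) x"
  by (cases k) (simp_all add: pderiv_hermite_poly_Suc)

text \<open>The derivative of p(x) exp(-x^2/2) is -(x p - p') exp(-x^2/2), so each differentiation
  contributes one sign and one step of the recursion.\<close>

lemma deriv_funpow_gauss:
  "(deriv ^^ k) (\<lambda>t. exp (- t\<^sup>2 / 2)) =
     (\<lambda>x. (- 1) ^ k * (poly (hermite_poly k) x * exp (- x\<^sup>2 / 2)))"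
proof (induction k)
  case (Suc k)
  have "deriv (\<lambda>x. (- 1) ^ k * (poly (hermite_poly k) x * exp (- x\<^sup>2 / 2))) x
      = (- 1) ^ Suc k * (poly (hermite_poly (Suc k)) x * exp (- x\<^sup>2 / 2))" for x
    by (intro DERIV_imp_deriv)
       (auto intro!: derivative_eq_intros simp: hermite_poly.simps(2) algebra_simps)
  then show ?case
    unfolding funpow.simps o_def Suc.IH by (intro ext)
qed simp

lemma hermite_eq_poly: "hermite k x = poly (hermite_poly k) x"
proof -
  have "((- 1) ^ k :: real) * (- 1) ^ k = 1"
    by (metis left_minus_one_mult_self mult.right_neutral)
  moreover have "exp (x\<^sup>2 / 2) * exp (- x\<^sup>2 / 2) = 1"
    by (simp flip: exp_add)
  ultimately show ?thesis
    unfolding hermite_def deriv_funpow_gauss by (simp add: algebra_simps)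
qed

section \<open>Integration by parts for one Gaussian variable\<close>

definition std_gauss :: "real measure" where
  "std_gauss = density lborel (\<lambda>x. ennreal (std_normal_density x))"

lemma prob_space_std_gauss: "prob_space std_gauss"
  unfolding std_gauss_def by (rule prob_space_normal_density) simp

lemma sets_std_gauss [measurable_cong, simp]: "sets std_gauss = sets borel"
  by (simp add: std_gauss_def)

lemma borel_measurable_poly [measurable]:
  fixes p :: "real poly"
  shows "poly p \<in> borel_measurable borel"
  by (intro borel_measurable_continuous_onI continuous_intros)

lemma integrable_normal_poly: "integrable lborel (\<lambda>x. std_normal_density x * poly p x)"
  unfolding poly_altdef sum_distrib_left
  using integrable_std_normal_moment
  by (intro Bochner_Integration.integrable_sum) (simp add: mult.left_commute)

lemma integrable_normal_poly_bounded:
  assumes "h \<in> borel_measurable borel" "\<And>x. \<bar>h x\<bar> \<le> B"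
  shows "integrable lborel (\<lambda>x. std_normal_density x * (poly p x * h x))"
proof (rule Bochner_Integration.integrable_bound)
  show "integrable lborel (\<lambda>x. B * (std_normal_density x * poly p x))"
    using integrable_normal_poly by simp
  show "(\<lambda>x. std_normal_density x * (poly p x * h x)) \<in> borel_measurable lborel"
    using assms(1) by measurable
  have B: "\<bar>h x\<bar> \<le> \<bar>B\<bar>" for x
    using assms(2)[of x] by linarith
  have "norm (std_normal_density x * (poly p x * h x)) \<le> norm (B * (std_normal_density x * poly p x))" for x
    using mult_right_mono[OF B[of x], of "\<bar>std_normal_density x * poly p x\<bar>"]
    by (simp add: abs_mult ac_simps)
  then show "AE x in lborel. norm (std_normal_density x * (poly p x * h x)) \<le> norm (B * (std_normal_density x * poly p x))"
    by simp
qed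

lemma integrable_std_gauss_poly: "integrable std_gauss (poly p)"
  unfolding std_gauss_def
  by (subst integrable_density) (auto simp: integrable_normal_poly)

lemma poly_times_gauss_tendsto_0:
  "((\<lambda>x. poly p x * std_normal_density x) \<longlongrightarrow> 0) at_top"
  "((\<lambda>x. poly p x * std_normal_density x) \<longlongrightarrow> 0) at_bot"
proof -
  have "((\<lambda>x::real. x ^ n * std_normal_density x) \<longlongrightarrow> 0) at_top" for n
    unfolding std_normal_density_def by real_asymp
  then show "((\<lambda>x. poly p x * std_normal_density x) \<longlongrightarrow> 0) at_top"
    unfolding poly_altdef sum_distrib_right mult.assoc
    by (intro tendsto_null_sum tendsto_mult_right_zero)
  have "((\<lambda>x::real. x ^ n * std_normal_density x) \<longlongrightarrow> 0) at_bot" for n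
    unfolding std_normal_density_def by real_asymp
  then show "((\<lambda>x. poly p x * std_normal_density x) \<longlongrightarrow> 0) at_bot"
    unfolding poly_altdef sum_distrib_right mult.assoc
    by (intro tendsto_null_sum tendsto_mult_right_zero)
qed

text \<open>Write \<phi> for the Gaussian density. As \<phi>' = -x \<phi>, the derivative of q
  \<psi> \<phi> is (q \<psi>' - (x q - q') \<psi>) \<phi>, and its integral over the line vanishes
  because \<phi> decays faster than any polynomial grows and \<psi> is bounded. A general polynomial
  q is allowed so that products of Hermite polynomials can be treated as well.\<close>

lemma std_gauss_integral_by_parts:
  fixes \<psi> \<psi>' :: "real \<Rightarrow> real"
  assumes deriv: "\<And>x. (\<psi> has_real_derivative \<psi>' x) (at x)"
    and cont: "continuous_on UNIV \<psi>'"
    and bound: "\<And>x. \<bar>\<psi> x\<bar> \<le> B" "\<And>x. \<bar>\<psi>' x\<bar> \<le> B'"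
  shows "(\<integral>x. poly ([:0, 1:] * q - pderiv q) x * \<psi> x \<partial>std_gauss) = (\<integral>x. poly q x * \<psi>' x \<partial>std_gauss)"
proof -
  have [measurable]: "\<psi>' \<in> borel_measurable borel"
    by (intro borel_measurable_continuous_onI cont)
  have cont': "continuous_on UNIV \<psi>"
    using deriv by (intro DERIV_continuous_on) (auto intro: DERIV_subset)
  then have [measurable]: "\<psi> \<in> borel_measurable borel"
    by (intro borel_measurable_continuous_onI)
  define r where "r = [:0, 1:] * q - pderiv q"
  define F where "F = (\<lambda>x. poly q x * \<psi> x * std_normal_density x)"
  define F' where "F' = (\<lambda>x. std_normal_density x * (poly q x * \<psi>' x) - std_normal_density x * (poly r x * \<psi> x))"
  have F: "(F has_real_derivative F' x) (at x)" for x
  proof -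
    have "((\<lambda>x. c * exp (- x\<^sup>2 / 2)) has_real_derivative - x * (c * exp (- x\<^sup>2 / 2))) (at x)" for c
      by (auto intro!: derivative_eq_intros)
    then have "(std_normal_density has_real_derivative - x * std_normal_density x) (at x)"
      unfolding std_normal_density_def .
    then show ?thesis
      unfolding F_def F'_def r_def
      by (auto intro!: derivative_eq_intros deriv simp: algebra_simps)
  qed
  have int1: "integrable lborel (\<lambda>x. std_normal_density x * (poly q x * \<psi>' x))"
    and int2: "integrable lborel (\<lambda>x. std_normal_density x * (poly r x * \<psi> x))"
    using integrable_normal_poly_bounded[OF _ bound(2)] integrable_normal_poly_bounded[OF _ bound(1)] by auto
  have B: "\<bar>\<psi> x\<bar> \<le> \<bar>B\<bar>" for x
    using bound(1)[of x] by linarith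
  have lim: "(F \<longlongrightarrow> 0) G" if "((\<lambda>x. poly q x * std_normal_density x) \<longlongrightarrow> 0) G" for G
  proof (rule tendsto_rabs_zero_cancel, rule tendsto_sandwich[where f = "\<lambda>_. 0"])
    show "((\<lambda>x. \<bar>B\<bar> * \<bar>poly q x * std_normal_density x\<bar>) \<longlongrightarrow> 0) G"
      using that by (intro tendsto_mult_right_zero tendsto_rabs_zero)
    have "\<bar>F x\<bar> \<le> \<bar>B\<bar> * \<bar>poly q x * std_normal_density x\<bar>" for x
      using mult_right_mono[OF B[of x], of "\<bar>poly q x * std_normal_density x\<bar>"]
      by (simp add: F_def abs_mult ac_simps)
    then show "\<forall>\<^sub>F x in G. \<bar>F x\<bar> \<le> \<bar>B\<bar> * \<bar>poly q x * std_normal_density x\<bar>"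
      by simp
  qed auto
  have "(LBINT x=-\<infinity>..\<infinity>. F' x) = 0 - 0"
  proof (rule interval_integral_FTC_integrable)
    show "(F has_vector_derivative F' x) (at x)" for x
      using F by (simp add: has_real_derivative_iff_has_vector_derivative)
    show "isCont F' x" for x
      using cont cont' unfolding F'_def std_normal_density_def
      by (auto simp: continuous_on_eq_continuous_at intro!: continuous_intros)
    show "set_integrable lborel (einterval (- \<infinity>) \<infinity>) F'"
      using int1 int2 by (simp add: F'_def set_integrable_def)
    show "((F \<circ> real_of_ereal) \<longlongrightarrow> 0) (at_right (- \<infinity>))"
      using lim[OF poly_times_gauss_tendsto_0(2)] by (simp add: ereal_tendsto_simps)
    show "((F \<circ> real_of_ereal) \<longlongrightarrow> 0) (at_left \<infinity>)"
      using lim[OF poly_times_gauss_tendsto_0(1)] by (simp add: ereal_tendsto_simps)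
  qed simp
  then have "(\<integral>x. F' x \<partial>lborel) = 0"
    by (simp add: interval_lebesgue_integral_le_eq set_lebesgue_integral_def)
  then show ?thesis
    using int1 int2 unfolding F'_def std_gauss_def r_def[symmetric]
    by (simp add: integral_density)
qed

section \<open>Gaussian vectors indexed by \<open>E\<close>\<close>

definition gauss_PiM :: "'e set \<Rightarrow> ('e \<Rightarrow> real) measure" where
  "gauss_PiM E = (\<Pi>\<^sub>M e\<in>E. std_gauss)"

lemma sets_gauss_PiM [measurable_cong]: "sets (gauss_PiM E) = sets (\<Pi>\<^sub>M e\<in>E. borel)"
  unfolding gauss_PiM_def by (intro sets_PiM_cong) auto

lemma prob_space_gauss_PiM: "prob_space (gauss_PiM E)"
  unfolding gauss_PiM_def by (intro prob_space_PiM prob_space_std_gauss)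

lemma integrable_gauss_PiM_poly:
  assumes "e \<in> E"
  shows "integrable (gauss_PiM E) (\<lambda>y. poly p (y e))"
proof -
  have "distr (gauss_PiM E) std_gauss (\<lambda>y. y e) = std_gauss"
    unfolding gauss_PiM_def using assms prob_space_std_gauss by (intro distr_PiM_component)
  then have "integrable (distr (gauss_PiM E) std_gauss (\<lambda>y. y e)) (poly p)"
    by (simp add: integrable_std_gauss_poly)
  moreover have "(\<lambda>y. y e) \<in> gauss_PiM E \<rightarrow>\<^sub>M std_gauss"
    using assms by measurable
  moreover have "poly p \<in> borel_measurable std_gauss"
    by (simp add: borel_measurable_poly measurable_cong_sets[OF sets_std_gauss refl])
  ultimately show ?thesis
    by (simp add: integrable_distr_eq)
qed

lemma integrable_mult_of_squares:
  fixes f g :: "'a \<Rightarrow> real"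
  assumes [measurable]: "f \<in> borel_measurable M" "g \<in> borel_measurable M"
    and "integrable M (\<lambda>x. (f x)\<^sup>2)" "integrable M (\<lambda>x. (g x)\<^sup>2)"
  shows "integrable M (\<lambda>x. f x * g x)"
proof (rule Bochner_Integration.integrable_bound)
  show "integrable M (\<lambda>x. (f x)\<^sup>2 + (g x)\<^sup>2)"
    using assms by simp
  have "\<bar>f x * g x\<bar> \<le> (f x)\<^sup>2 + (g x)\<^sup>2" for x
    using sum_squares_bound[of "\<bar>f x\<bar>" "\<bar>g x\<bar>"] mult_nonneg_nonneg[of "\<bar>f x\<bar>" "\<bar>g x\<bar>"]
    unfolding abs_mult power2_abs by linarith
  then show "AE x in M. norm (f x * g x) \<le> norm ((f x)\<^sup>2 + (g x)\<^sup>2)"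
    by simp
qed measurable

text \<open>The absolute value stands inside the integral so that a bounded third factor can be
  removed before Cauchy-Schwarz is applied.\<close>

lemma integral_abs_mult_le_sqrt:
  fixes f g :: "'a \<Rightarrow> real"
  assumes [measurable]: "f \<in> borel_measurable M" "g \<in> borel_measurable M"
    and f: "integrable M (\<lambda>x. (f x)\<^sup>2)" and g: "integrable M (\<lambda>x. (g x)\<^sup>2)"
  shows "(\<integral>x. \<bar>f x * g x\<bar> \<partial>M) \<le> sqrt ((\<integral>x. (f x)\<^sup>2 \<partial>M) * (\<integral>x. (g x)\<^sup>2 \<partial>M))"
proof -
  have nn: "(\<integral>\<^sup>+x. ennreal (h x) \<partial>M) = ennreal (\<integral>x. h x \<partial>M)" if "integrable M h" "\<And>x. 0 \<le> h x" for h
    using that by (intro nn_integral_eq_integral) auto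
  have fg: "integrable M (\<lambda>x. \<bar>f x * g x\<bar>)"
    using integrable_mult_of_squares[OF assms] by (rule integrable_abs)
  have "(\<integral>\<^sup>+x. ennreal \<bar>f x\<bar> * ennreal \<bar>g x\<bar> \<partial>M)\<^sup>2
      \<le> (\<integral>\<^sup>+x. (ennreal \<bar>f x\<bar>)\<^sup>2 \<partial>M) * (\<integral>\<^sup>+x. (ennreal \<bar>g x\<bar>)\<^sup>2 \<partial>M)"
    by (rule Cauchy_Schwarz_nn_integral) auto
  also have "(\<lambda>x. ennreal \<bar>f x\<bar> * ennreal \<bar>g x\<bar>) = (\<lambda>x. ennreal \<bar>f x * g x\<bar>)"
    by (simp add: abs_mult ennreal_mult)
  also have "(\<lambda>x. (ennreal \<bar>f x\<bar>)\<^sup>2) = (\<lambda>x. ennreal ((f x)\<^sup>2))"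
    by (simp add: ennreal_power)
  also have "(\<lambda>x. (ennreal \<bar>g x\<bar>)\<^sup>2) = (\<lambda>x. ennreal ((g x)\<^sup>2))"
    by (simp add: ennreal_power)
  finally have "ennreal ((\<integral>x. \<bar>f x * g x\<bar> \<partial>M)\<^sup>2) \<le> ennreal ((\<integral>x. (f x)\<^sup>2 \<partial>M) * (\<integral>x. (g x)\<^sup>2 \<partial>M))"
    using f g fg by (simp add: nn ennreal_power ennreal_mult)
  then have "(\<integral>x. \<bar>f x * g x\<bar> \<partial>M)\<^sup>2 \<le> (\<integral>x. (f x)\<^sup>2 \<partial>M) * (\<integral>x. (g x)\<^sup>2 \<partial>M)"
    by (subst (asm) ennreal_le_iff) auto
  then show ?thesis
    by (rule real_le_rsqrt)
qed

lemma integrable_gauss_PiM_poly_poly: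
  assumes "e \<in> E" "e' \<in> E"
  shows "integrable (gauss_PiM E) (\<lambda>y. poly p (y e) * poly q (y e'))"
  using integrable_gauss_PiM_poly[OF assms(1), of "p\<^sup>2"] integrable_gauss_PiM_poly[OF assms(2), of "q\<^sup>2"] assms
  by (intro integrable_mult_of_squares) (auto simp: poly_power)

lemma integrable_mult_bounded:
  fixes f g :: "'a \<Rightarrow> real"
  assumes "integrable M f" "g \<in> borel_measurable M" "\<And>x. x \<in> space M \<Longrightarrow> \<bar>g x\<bar> \<le> B"
  shows "integrable M (\<lambda>x. f x * g x)"
proof (rule Bochner_Integration.integrable_bound)
  show "integrable M (\<lambda>x. B * f x)"
    using assms(1) by simp
  show "AE x in M. norm (f x * g x) \<le> norm (B * f x)"
  proof (rule AE_I2)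
    fix x assume "x \<in> space M"
    then have "\<bar>g x\<bar> \<le> \<bar>B\<bar>"
      using assms(3)[of x] by linarith
    from mult_right_mono[OF this, of "\<bar>f x\<bar>"] show "norm (f x * g x) \<le> norm (B * f x)"
      by (simp add: abs_mult mult.commute)
  qed
qed (use assms in auto)

text \<open>Fubini isolates the coordinate \<open>e\<close>; there \<open>c\<close> is constant and
  leaves the inner integral, to which the one-dimensional formula applies. In use \<open>c\<close>
  is 1 or a Hermite polynomial in another coordinate.\<close>

lemma gauss_PiM_integral_by_parts:
  fixes c \<Phi> \<Phi>' :: "('e \<Rightarrow> real) \<Rightarrow> real"
  assumes E: "finite E" "e \<in> E"
    and c: "\<And>y t. c (y(e := t)) = c y" "\<And>p. integrable (gauss_PiM E) (\<lambda>y. c y * poly p (y e))"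
    and [measurable]: "\<Phi> \<in> borel_measurable (gauss_PiM E)" "\<Phi>' \<in> borel_measurable (gauss_PiM E)"
    and bound: "\<And>y. \<bar>\<Phi> y\<bar> \<le> B" "\<And>y. \<bar>\<Phi>' y\<bar> \<le> B'"
    and deriv: "\<And>y t. ((\<lambda>t. \<Phi> (y(e := t))) has_real_derivative \<Phi>' (y(e := t))) (at t)"
    and cont: "\<And>y. continuous_on UNIV (\<lambda>t. \<Phi>' (y(e := t)))"
  shows "(\<integral>y. c y * poly ([:0, 1:] * q - pderiv q) (y e) * \<Phi> y \<partial>gauss_PiM E)
       = (\<integral>y. c y * poly q (y e) * \<Phi>' y \<partial>gauss_PiM E)"
proof -
  interpret product_sigma_finite "\<lambda>_::'e. std_gauss"
    by (intro product_sigma_finite.intro prob_space_imp_sigma_finite prob_space_std_gauss)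
  have E': "gauss_PiM E = (\<Pi>\<^sub>M e\<in>insert e (E - {e}). std_gauss)"
    unfolding gauss_PiM_def using E by (simp add: insert_absorb)
  have fin: "finite (E - {e})" "e \<notin> E - {e}"
    using E by auto
  have int: "integrable (gauss_PiM E) (\<lambda>y. c y * poly r (y e) * \<Phi> y)"
    "integrable (gauss_PiM E) (\<lambda>y. c y * poly r (y e) * \<Phi>' y)" for r
    by (rule integrable_mult_bounded[OF c(2)], fact, rule bound)+
  have inner: "(\<integral>t. poly ([:0, 1:] * q - pderiv q) t * \<Phi> (x(e := t)) \<partial>std_gauss)
      = (\<integral>t. poly q t * \<Phi>' (x(e := t)) \<partial>std_gauss)" for x
    by (rule std_gauss_integral_by_parts[OF deriv cont bound])
  note insert = product_integral_insert[OF fin, folded E']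
  show ?thesis
    unfolding insert[OF int(1)] insert[OF int(2)]
    unfolding c(1) fun_upd_same mult.assoc
    by (simp only: integral_mult_right_zero inner)
qed


text \<open>This is integration by parts against the constant function 1, whose derivative
  vanishes.\<close>

lemma gauss_PiM_integral_adjoint_eq_0:
  fixes c :: "('e \<Rightarrow> real) \<Rightarrow> real"
  assumes "finite E" "e \<in> E"
    and "\<And>y t. c (y(e := t)) = c y" "\<And>p. integrable (gauss_PiM E) (\<lambda>y. c y * poly p (y e))"
  shows "(\<integral>y. c y * poly ([:0, 1:] * q - pderiv q) (y e) \<partial>gauss_PiM E) = 0"
  using gauss_PiM_integral_by_parts[OF assms, where \<Phi> = "\<lambda>_. 1" and \<Phi>' = "\<lambda>_. 0" and q = q and B = 1 and B' = 0]
  by simp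

text \<open>The polynomial in \<open>y e\<close> lies in the range of the adjoint operator, and the
  one in \<open>y e'\<close> serves as the weight. Positive degree matters: H_0 = 1 does not have
  mean zero.\<close>

lemma gauss_PiM_hermite_orthogonal:
  assumes "finite E" "e \<in> E" "e' \<in> E" "e \<noteq> e'"
  shows "(\<integral>y. poly (hermite_poly (Suc k)) (y e') * poly (hermite_poly (Suc k)) (y e) \<partial>gauss_PiM E) = 0"
  using gauss_PiM_integral_adjoint_eq_0[OF assms(1,2), where q = "hermite_poly k"
      and c = "\<lambda>y. poly (hermite_poly (Suc k)) (y e')"] assms integrable_gauss_PiM_poly_poly[OF assms(3,2)]
  unfolding hermite_poly.simps(2)[symmetric] by simp

lemma gauss_PiM_hermite_square:
  assumes E: "finite E" "e \<in> E"
  shows "(\<integral>y. (poly (hermite_poly k) (y e))\<^sup>2 \<partial>gauss_PiM E) = fact k"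
proof (induction k)
  case 0
  interpret prob_space "gauss_PiM E" by (rule prob_space_gauss_PiM)
  show ?case by (simp add: prob_space)
next
  case (Suc k)
  let ?q = "hermite_poly k * hermite_poly (Suc k)"
  note int = integrable_gauss_PiM_poly[OF E(2)]
  have int2: "integrable (gauss_PiM E) (\<lambda>y. (poly p (y e))\<^sup>2)" for p
    using int[of "p\<^sup>2"] by simp
  \<comment> \<open>Applying the adjoint operator to H_k H_(k+1) gives H_(k+1)^2 - (k+1) H_k^2. Its
    mean is zero, so the second moment gains the factor k+1.\<close>
  have "(poly (hermite_poly (Suc k)) x)\<^sup>2
      = poly ([:0, 1:] * ?q - pderiv ?q) x + real (Suc k) * (poly (hermite_poly k) x)\<^sup>2" for x
  proof -
    have "poly (hermite_poly (Suc k)) x = x * poly (hermite_poly k) x - poly (pderiv (hermite_poly k)) x"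
      by (simp add: hermite_poly.simps(2))
    moreover have "poly (pderiv ?q) x = poly (hermite_poly k) x * (real (Suc k) * poly (hermite_poly k) x)
        + poly (hermite_poly (Suc k)) x * poly (pderiv (hermite_poly k)) x"
      by (simp add: pderiv_mult poly_pderiv_hermite_poly)
    moreover have "poly ([:0, 1:] * ?q - pderiv ?q) x
        = x * (poly (hermite_poly k) x * poly (hermite_poly (Suc k)) x) - poly (pderiv ?q) x"
      by simp
    ultimately show ?thesis
      by algebra
  qed
  then have "(\<integral>y. (poly (hermite_poly (Suc k)) (y e))\<^sup>2 \<partial>gauss_PiM E)
     = (\<integral>y. poly ([:0, 1:] * ?q - pderiv ?q) (y e) \<partial>gauss_PiM E) + real (Suc k) * fact k"
    using Suc.IH int[of "[:0, 1:] * ?q - pderiv ?q"] int2[of "hermite_poly k"]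
    by (simp only: Bochner_Integration.integral_add integrable_mult_right integral_mult_right_zero)
  also have "(\<integral>y. poly ([:0, 1:] * ?q - pderiv ?q) (y e) \<partial>gauss_PiM E) = 0"
    using gauss_PiM_integral_adjoint_eq_0[OF E, where c = "\<lambda>_. 1" and q = ?q] int by simp
  finally show ?case by simp
qed

text \<open>Only the diagonal of the double sum survives orthogonality. The index set is a subset
  \<open>I\<close> because the second bound of the theorem leaves out one index of
  \<open>E\<close>.\<close>

lemma gauss_PiM_hermite_sum_square:
  fixes b :: "'e \<Rightarrow> real" and k :: nat
  assumes E: "finite E" "I \<subseteq> E"
  defines "X \<equiv> \<lambda>y. \<Sum>e\<in>I. b e * poly (hermite_poly (Suc k)) (y e)"
  shows "integrable (gauss_PiM E) (\<lambda>y. (X y)\<^sup>2)"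
    and "(\<integral>y. (X y)\<^sup>2 \<partial>gauss_PiM E) = fact (Suc k) * (\<Sum>e\<in>I. (b e)\<^sup>2)"
proof -
  let ?h = "poly (hermite_poly (Suc k))"
  have I: "finite I" "\<And>e. e \<in> I \<Longrightarrow> e \<in> E"
    using E finite_subset by auto
  have eq: "(X y)\<^sup>2 = (\<Sum>e\<in>I. \<Sum>e'\<in>I. b e * b e' * (?h (y e) * ?h (y e')))" for y
    unfolding X_def power2_eq_square sum_product by (simp add: ac_simps)
  have int: "integrable (gauss_PiM E) (\<lambda>y. b e * b e' * (?h (y e) * ?h (y e')))" if "e \<in> I" "e' \<in> I" for e e'
    by (intro integrable_mult_right integrable_gauss_PiM_poly_poly that I)
  show "integrable (gauss_PiM E) (\<lambda>y. (X y)\<^sup>2)"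
    unfolding eq by (intro Bochner_Integration.integrable_sum int)
  have "(\<integral>y. (X y)\<^sup>2 \<partial>gauss_PiM E) =
      (\<Sum>e\<in>I. \<Sum>e'\<in>I. b e * b e' * (\<integral>y. ?h (y e) * ?h (y e') \<partial>gauss_PiM E))"
    unfolding eq using int
    by (simp add: Bochner_Integration.integral_sum Bochner_Integration.integrable_sum)
  also have "\<dots> = (\<Sum>e\<in>I. \<Sum>e'\<in>I. if e = e' then fact (Suc k) * (b e)\<^sup>2 else 0)"
  proof (intro sum.cong refl)
    fix e e' assume "e \<in> I" "e' \<in> I"
    then have "e \<in> E" "e' \<in> E"
      using I by auto
    then show "b e * b e' * (\<integral>y. ?h (y e) * ?h (y e') \<partial>gauss_PiM E) = (if e = e' then fact (Suc k) * (b e)\<^sup>2 else 0)"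
      using gauss_PiM_hermite_orthogonal[OF E(1), of e' e k] gauss_PiM_hermite_square[OF E(1), of e "Suc k"]
      by (cases "e = e'") (simp_all add: power2_eq_square)
  qed
  also have "\<dots> = fact (Suc k) * (\<Sum>e\<in>I. (b e)\<^sup>2)"
    using I by (simp add: sum_distrib_left)
  finally show "(\<integral>y. (X y)\<^sup>2 \<partial>gauss_PiM E) = fact (Suc k) * (\<Sum>e\<in>I. (b e)\<^sup>2)" .
qed

section \<open>Gibbs averages and their derivatives\<close>

text \<open>This is the Maclaurin remainder of order two. On the interval in question the
  exponential is at most 4, a crude bound for \<open>exp 1\<close>, and half of that is the constant
  2.\<close>

lemma abs_exp_minus_linear_le:
  fixes d :: real
  assumes "\<bar>d\<bar> \<le> 1"
  shows "\<bar>exp d - 1 - d\<bar> \<le> 2 * d\<^sup>2"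
proof -
  obtain t where t: "\<bar>t\<bar> \<le> \<bar>d\<bar>" and d: "exp d = (\<Sum>m<2. d ^ m / fact m) + exp t / fact 2 * d ^ 2"
    using Maclaurin_exp_le by blast
  have "exp t \<le> exp 1"
    using t assms by simp
  then have "exp t \<le> 4"
    using exp_le by linarith
  then have "exp t / 2 * d\<^sup>2 \<le> 2 * d\<^sup>2"
    by (intro mult_right_mono) auto
  moreover have "exp d - 1 - d = exp t / 2 * d\<^sup>2"
    using d by (simp add: numeral_2_eq_2)
  moreover have "0 \<le> exp t / 2 * d\<^sup>2"
    by simp
  ultimately show ?thesis
    by linarith
qed

lemma integrable_exp_bounded:
  fixes \<phi> h :: "'a \<Rightarrow> real"
  assumes "finite_measure \<nu>"
    and [measurable]: "\<phi> \<in> borel_measurable \<nu>" "h \<in> borel_measurable \<nu>"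
    and "\<And>x. x \<in> space \<nu> \<Longrightarrow> \<bar>\<phi> x\<bar> \<le> K" "\<And>x. x \<in> space \<nu> \<Longrightarrow> \<bar>h x\<bar> \<le> B"
  shows "integrable \<nu> (\<lambda>x. exp (\<phi> x) * h x)"
proof -
  interpret finite_measure \<nu> by fact
  have "\<phi> x \<le> K" if "x \<in> space \<nu>" for x
    using assms(4)[OF that] by linarith
  then have "integrable \<nu> (\<lambda>x. exp (\<phi> x))"
    by (intro integrable_const_bound[where B = "exp K"]) auto
  then show ?thesis
    using assms(3,5) by (rule integrable_mult_bounded)
qed

text \<open>The error of the difference quotient is estimated directly: factoring out
  \<open>exp (t * \<phi> x) * h x\<close> leaves the second-order remainder of the exponential, so
  after division by the increment d the error is at most a constant times |d|.\<close>

lemma has_derivative_integral_exp: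
  fixes \<phi> h :: "'a \<Rightarrow> real"
  assumes fin: "finite_measure \<nu>"
    and [measurable]: "\<phi> \<in> borel_measurable \<nu>" "h \<in> borel_measurable \<nu>"
    and \<phi>: "\<And>x. x \<in> space \<nu> \<Longrightarrow> \<bar>\<phi> x\<bar> \<le> 1" and h: "\<And>x. x \<in> space \<nu> \<Longrightarrow> \<bar>h x\<bar> \<le> B"
  shows "((\<lambda>t. \<integral>x. exp (t * \<phi> x) * h x \<partial>\<nu>) has_real_derivative
           (\<integral>x. exp (t * \<phi> x) * (\<phi> x * h x) \<partial>\<nu>)) (at t)"
proof -
  define n where "n = (\<lambda>t. \<integral>x. exp (t * \<phi> x) * h x \<partial>\<nu>)"
  define n' where "n' = (\<integral>x. exp (t * \<phi> x) * (\<phi> x * h x) \<partial>\<nu>)"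
  define K where "K = (\<integral>x. exp (t * \<phi> x) * \<bar>h x\<bar> \<partial>\<nu>)"
  have bd: "\<bar>s * \<phi> x\<bar> \<le> \<bar>s\<bar>" if "x \<in> space \<nu>" for s x
    using mult_left_mono[OF \<phi>[OF that], of "\<bar>s\<bar>"] by (simp add: abs_mult)
  have "\<bar>\<phi> x * h x\<bar> \<le> 1 * B" if "x \<in> space \<nu>" for x
    unfolding abs_mult using \<phi>[OF that] h[OF that] by (intro mult_mono) auto
  then have bd': "\<bar>\<phi> x * h x\<bar> \<le> B" if "x \<in> space \<nu>" for x
    using that by simp
  have int0: "integrable \<nu> (\<lambda>x. exp (s * \<phi> x) * g x)"
    if "g \<in> borel_measurable \<nu>" "\<And>x. x \<in> space \<nu> \<Longrightarrow> \<bar>g x\<bar> \<le> B" for s g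
    using fin _ that(1) bd that(2) by (rule integrable_exp_bounded) simp
  have int: "integrable \<nu> (\<lambda>x. exp (s * \<phi> x) * h x)"
      "integrable \<nu> (\<lambda>x. exp (s * \<phi> x) * (\<phi> x * h x))"
      "integrable \<nu> (\<lambda>x. exp (s * \<phi> x) * \<bar>h x\<bar>)" for s
    by (rule int0; simp add: h bd')+
  have bound: "\<bar>(n (t + d) - n t) / d - n'\<bar> \<le> 2 * K * \<bar>d\<bar>" if d: "\<bar>d\<bar> \<le> 1" "d \<noteq> 0" for d
  proof -
    have eq: "n (t + d) - n t - d * n'
        = (\<integral>x. exp ((t + d) * \<phi> x) * h x - exp (t * \<phi> x) * h x - d * (exp (t * \<phi> x) * (\<phi> x * h x)) \<partial>\<nu>)"
      unfolding n_def n'_def using int by (simp add: Bochner_Integration.integral_diff)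
    have "\<bar>n (t + d) - n t - d * n'\<bar> \<le> (\<integral>x. \<bar>exp ((t + d) * \<phi> x) * h x - exp (t * \<phi> x) * h x - d * (exp (t * \<phi> x) * (\<phi> x * h x))\<bar> \<partial>\<nu>)"
      unfolding eq by (rule integral_abs_bound)
    also have "\<dots> \<le> (\<integral>x. 2 * d\<^sup>2 * (exp (t * \<phi> x) * \<bar>h x\<bar>) \<partial>\<nu>)"
    proof (rule integral_mono)
      show "integrable \<nu> (\<lambda>x. \<bar>exp ((t + d) * \<phi> x) * h x - exp (t * \<phi> x) * h x - d * (exp (t * \<phi> x) * (\<phi> x * h x))\<bar>)"
        using int(1)[of "t + d"] int(1)[of t] int(2)[of t] by simp
      show "integrable \<nu> (\<lambda>x. 2 * d\<^sup>2 * (exp (t * \<phi> x) * \<bar>h x\<bar>))"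
        using int(3)[of t] by simp
      fix x assume x: "x \<in> space \<nu>"
      have d': "\<bar>d * \<phi> x\<bar> \<le> \<bar>d\<bar>"
        using bd[OF x] .
      then have "(d * \<phi> x)\<^sup>2 \<le> d\<^sup>2"
        by (simp only: abs_le_square_iff)
      moreover have "\<bar>exp (d * \<phi> x) - 1 - d * \<phi> x\<bar> \<le> 2 * (d * \<phi> x)\<^sup>2"
        using d' d(1) by (intro abs_exp_minus_linear_le) linarith
      ultimately have "\<bar>exp (d * \<phi> x) - 1 - d * \<phi> x\<bar> \<le> 2 * d\<^sup>2"
        by linarith
      then have "(exp (t * \<phi> x) * \<bar>h x\<bar>) * \<bar>exp (d * \<phi> x) - 1 - d * \<phi> x\<bar> \<le> (exp (t * \<phi> x) * \<bar>h x\<bar>) * (2 * d\<^sup>2)"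
        by (rule mult_left_mono) simp
      moreover have "exp ((t + d) * \<phi> x) * h x - exp (t * \<phi> x) * h x - d * (exp (t * \<phi> x) * (\<phi> x * h x))
          = exp (t * \<phi> x) * h x * (exp (d * \<phi> x) - 1 - d * \<phi> x)"
        by (simp add: distrib_right exp_add) (simp add: algebra_simps)
      ultimately show "\<bar>exp ((t + d) * \<phi> x) * h x - exp (t * \<phi> x) * h x - d * (exp (t * \<phi> x) * (\<phi> x * h x))\<bar>
          \<le> 2 * d\<^sup>2 * (exp (t * \<phi> x) * \<bar>h x\<bar>)"
        by (simp only: abs_mult abs_exp_cancel mult.commute[of "2 * d\<^sup>2"])
    qed
    also have "\<dots> = 2 * K * \<bar>d\<bar> * \<bar>d\<bar>"
      unfolding K_def by (simp add: power2_eq_square)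
    finally have "\<bar>(n (t + d) - n t - d * n') / d\<bar> \<le> 2 * K * \<bar>d\<bar>"
      using d by (simp add: abs_divide divide_le_eq)
    moreover have "(n (t + d) - n t - d * n') / d = (n (t + d) - n t) / d - n'"
      using d by (simp add: diff_divide_distrib)
    ultimately show ?thesis
      by simp
  qed
  have "((\<lambda>d. (n (t + d) - n t) / d - n') \<longlongrightarrow> 0) (at 0)"
  proof (rule Lim_null_comparison)
    show "((\<lambda>d. 2 * K * \<bar>d\<bar>) \<longlongrightarrow> 0) (at 0)"
      by (auto intro!: tendsto_eq_intros)
    have "\<forall>\<^sub>F d in at (0::real). \<bar>d\<bar> \<le> 1 \<and> d \<noteq> 0"
      by (auto simp: eventually_at intro!: exI[of _ 1])
    then show "\<forall>\<^sub>F d in at 0. norm ((n (t + d) - n t) / d - n') \<le> 2 * K * \<bar>d\<bar>"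
      by eventually_elim (use bound in auto)
  qed
  then show ?thesis
    unfolding DERIV_def n_def[symmetric] n'_def[symmetric] by (rule LIM_zero_cancel)
qed

text \<open>The integrand depends on \<open>x\<close>, whereas integration of a fixed function
  against a kernel is known to be measurable. Pushing \<open>L x\<close> forward along
  \<open>y\<close> to \<open>(x, y)\<close> moves the dependence from the integrand into the
  kernel.\<close>

lemma borel_measurable_integral_kernel:
  fixes h :: "'a \<Rightarrow> 'b \<Rightarrow> real"
  assumes [measurable]: "(\<lambda>(x, y). h x y) \<in> borel_measurable (M \<Otimes>\<^sub>M N)"
    and L[measurable]: "L \<in> M \<rightarrow>\<^sub>M subprob_algebra N"
  shows "(\<lambda>x. \<integral>y. h x y \<partial>L x) \<in> borel_measurable M"
proof -
  note integral_measurable_subprob_algebra[measurable] measurable_distr2[measurable]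
  have "(\<lambda>x. integral\<^sup>L (distr (L x) (M \<Otimes>\<^sub>M N) (\<lambda>y. (x, y))) (\<lambda>(x, y). h x y)) \<in> borel_measurable M"
    by measurable
  then show ?thesis
  proof (rule measurable_cong[THEN iffD1, rotated])
    fix x assume x: "x \<in> space M"
    then have [measurable]: "Pair x \<in> L x \<rightarrow>\<^sub>M M \<Otimes>\<^sub>M N"
      using measurable_Pair1'[OF x] sets_kernel[OF L x] by (simp cong: measurable_cong_sets)
    show "integral\<^sup>L (distr (L x) (M \<Otimes>\<^sub>M N) (\<lambda>y. (x, y))) (\<lambda>(x, y). h x y) = (\<integral>y. h x y \<partial>L x)"
      by (simp add: integral_distr)
  qed
qed

text \<open>Only the disorder carried by \<open>H\<close> is random here. The Gaussian values enter
  the Gibbs averages as a free argument \<open>y\<close>, so that single coordinates can be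
  differentiated and integrated out.\<close>

locale gibbs_model =
  fixes H :: "'w measure" and S :: "'s measure" and E :: "'e set"
    and f :: "'w \<Rightarrow> 'e \<Rightarrow> 's \<Rightarrow> real" and \<mu> :: "'w \<Rightarrow> 's measure" and \<gamma> :: real
  assumes finite_E: "finite E"
    and \<gamma>_pos: "\<gamma> > 0"
    and f_measurable: "\<And>e. e \<in> E \<Longrightarrow> (\<lambda>(\<omega>, \<sigma>). f \<omega> e \<sigma>) \<in> borel_measurable (H \<Otimes>\<^sub>M S)"
    and f_range: "\<And>\<omega> e \<sigma>. \<omega> \<in> space H \<Longrightarrow> e \<in> E \<Longrightarrow> \<sigma> \<in> space S \<Longrightarrow> \<bar>f \<omega> e \<sigma>\<bar> \<le> 1"
    and random_measure: "random_finite_measure H S \<mu>"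
begin

abbreviation avg :: "'w \<Rightarrow> ('e \<Rightarrow> real) \<Rightarrow> ('s \<Rightarrow> real) \<Rightarrow> real" where
  "avg \<omega> \<equiv> gibbs_avg \<gamma> E (f \<omega>) (\<mu> \<omega>)"

abbreviation Z :: "'w \<Rightarrow> ('e \<Rightarrow> real) \<Rightarrow> real" where
  "Z \<omega> \<equiv> partition_fun \<gamma> E (f \<omega>) (\<mu> \<omega>)"

lemma finite_\<mu>: "\<omega> \<in> space H \<Longrightarrow> finite_measure (\<mu> \<omega>)"
  and sets_\<mu>: "\<omega> \<in> space H \<Longrightarrow> sets (\<mu> \<omega>) = sets S"
  and \<mu>_nonzero: "\<omega> \<in> space H \<Longrightarrow> emeasure (\<mu> \<omega>) (space S) \<noteq> 0"
  and emeasure_\<mu>_measurable: "A \<in> sets S \<Longrightarrow> (\<lambda>\<omega>. emeasure (\<mu> \<omega>) A) \<in> borel_measurable H"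
  using random_measure unfolding random_finite_measure_def by auto

lemma space_\<mu>: "\<omega> \<in> space H \<Longrightarrow> space (\<mu> \<omega>) = space S"
  by (rule sets_eq_imp_space_eq[OF sets_\<mu>])

lemma section_measurable:
  assumes "\<omega> \<in> space H" "(\<lambda>(\<omega>, \<sigma>). h \<omega> \<sigma>) \<in> borel_measurable (H \<Otimes>\<^sub>M S)"
  shows "h \<omega> \<in> borel_measurable (\<mu> \<omega>)"
  using measurable_Pair2[OF assms(2,1)] unfolding measurable_cong_sets[OF sets_\<mu>[OF assms(1)] refl]
  by simp

lemma f_measurable_\<mu>: "\<omega> \<in> space H \<Longrightarrow> e \<in> E \<Longrightarrow> f \<omega> e \<in> borel_measurable (\<mu> \<omega>)"
  by (rule section_measurable[OF _ f_measurable])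

lemma f_range_\<mu>: "\<omega> \<in> space H \<Longrightarrow> e \<in> E \<Longrightarrow> \<sigma> \<in> space (\<mu> \<omega>) \<Longrightarrow> \<bar>f \<omega> e \<sigma>\<bar> \<le> 1"
  by (simp add: space_\<mu> f_range)

lemma weighted_sum_bound:
  assumes "\<omega> \<in> space H" "\<sigma> \<in> space (\<mu> \<omega>)" "I \<subseteq> E"
  shows "\<bar>\<Sum>e\<in>I. y e * f \<omega> e \<sigma>\<bar> \<le> (\<Sum>e\<in>I. \<bar>y e\<bar>)"
proof -
  have "\<bar>y e * f \<omega> e \<sigma>\<bar> \<le> \<bar>y e\<bar>" if "e \<in> I" for e
    using mult_left_mono[OF f_range_\<mu>[OF assms(1) _ assms(2), of e], of "\<bar>y e\<bar>"] that assms(3)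
    by (auto simp: abs_mult)
  then show ?thesis
    by (intro sum_abs[THEN order_trans] sum_mono)
qed

lemma energy_measurable: "\<omega> \<in> space H \<Longrightarrow> energy E (f \<omega>) y \<in> borel_measurable (\<mu> \<omega>)"
  unfolding energy_def by (intro borel_measurable_sum borel_measurable_times f_measurable_\<mu>) auto

lemma energy_bound:
  assumes "\<omega> \<in> space H" "\<sigma> \<in> space (\<mu> \<omega>)"
  shows "\<bar>\<gamma> * energy E (f \<omega>) y \<sigma>\<bar> \<le> \<gamma> * (\<Sum>e\<in>E. \<bar>y e\<bar>)"
  using weighted_sum_bound[OF assms order_refl, of y] \<gamma>_pos
  by (simp add: energy_def abs_mult)

lemma weight_integrable:
  fixes B :: real
  assumes "\<omega> \<in> space H" "h \<in> borel_measurable (\<mu> \<omega>)" "\<And>\<sigma>. \<sigma> \<in> space (\<mu> \<omega>) \<Longrightarrow> \<bar>h \<sigma>\<bar> \<le> B"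
  shows "integrable (\<mu> \<omega>) (\<lambda>\<sigma>. exp (\<gamma> * energy E (f \<omega>) y \<sigma>) * h \<sigma>)"
  using energy_measurable[OF assms(1)] energy_bound[OF assms(1)] assms
  by (intro integrable_exp_bounded[OF finite_\<mu>]) auto

lemma Z_pos:
  assumes "\<omega> \<in> space H"
  shows "Z \<omega> y > 0"
proof -
  interpret finite_measure "\<mu> \<omega>" by (rule finite_\<mu>[OF assms])
  define K where "K = \<gamma> * (\<Sum>e\<in>E. \<bar>y e\<bar>)"
  have "0 < exp (- K) * measure (\<mu> \<omega>) (space (\<mu> \<omega>))"
    using \<mu>_nonzero[OF assms] by (simp add: space_\<mu>[OF assms] measure_nonneg less_le emeasure_eq_measure)
  also have "\<dots> = (\<integral>\<sigma>. exp (- K) \<partial>\<mu> \<omega>)"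
    by (simp add: mult.commute)
  also have "\<dots> \<le> Z \<omega> y"
    unfolding partition_fun_def
  proof (rule integral_mono)
    show "integrable (\<mu> \<omega>) (\<lambda>\<sigma>. exp (\<gamma> * energy E (f \<omega>) y \<sigma>))"
      using weight_integrable[OF assms, of "\<lambda>_. 1" 1 y] by simp
    show "exp (- K) \<le> exp (\<gamma> * energy E (f \<omega>) y \<sigma>)" if "\<sigma> \<in> space (\<mu> \<omega>)" for \<sigma>
      using energy_bound[OF assms that, of y] unfolding K_def exp_le_cancel_iff by linarith
  qed simp
  finally show ?thesis .
qed

lemma avg_eq:
  assumes "\<omega> \<in> space H" "h \<in> borel_measurable (\<mu> \<omega>)"
  shows "avg \<omega> y h = (\<integral>\<sigma>. exp (\<gamma> * energy E (f \<omega>) y \<sigma>) * h \<sigma> \<partial>\<mu> \<omega>) / Z \<omega> y"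
  unfolding gibbs_avg_def gibbs_def
  by (subst integral_density) (use assms Z_pos[OF assms(1), of y] energy_measurable[OF assms(1)] in \<open>auto simp: less_imp_le\<close>)

lemma gibbs_prob_space:
  assumes "\<omega> \<in> space H"
  shows "prob_space (gibbs \<gamma> E (f \<omega>) (\<mu> \<omega>) y)"
proof
  note [measurable] = energy_measurable[OF assms, of y]
  let ?w = "\<lambda>\<sigma>. exp (\<gamma> * energy E (f \<omega>) y \<sigma>)"
  have "integrable (\<mu> \<omega>) (\<lambda>\<sigma>. ?w \<sigma> / Z \<omega> y)"
    using weight_integrable[OF assms, of "\<lambda>_. 1" 1 y] by simp
  then have "(\<integral>\<^sup>+\<sigma>. ennreal (?w \<sigma> / Z \<omega> y) \<partial>\<mu> \<omega>) = ennreal (\<integral>\<sigma>. ?w \<sigma> / Z \<omega> y \<partial>\<mu> \<omega>)"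
    using Z_pos[OF assms, of y] by (intro nn_integral_eq_integral) (auto simp: less_imp_le)
  also have "(\<integral>\<sigma>. ?w \<sigma> / Z \<omega> y \<partial>\<mu> \<omega>) = 1"
    using Z_pos[OF assms, of y] by (simp add: partition_fun_def)
  finally show "emeasure (gibbs \<gamma> E (f \<omega>) (\<mu> \<omega>) y) (space (gibbs \<gamma> E (f \<omega>) (\<mu> \<omega>) y)) = 1"
    by (simp add: gibbs_def emeasure_density cong: nn_integral_cong)
qed

lemma sets_gibbs: "sets (gibbs \<gamma> E (f \<omega>) (\<mu> \<omega>) y) = sets (\<mu> \<omega>)"
  and space_gibbs: "space (gibbs \<gamma> E (f \<omega>) (\<mu> \<omega>) y) = space (\<mu> \<omega>)"
  by (simp_all add: gibbs_def)

lemma gibbs_integrable: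
  fixes B :: real
  assumes "\<omega> \<in> space H" "h \<in> borel_measurable (\<mu> \<omega>)" "\<And>\<sigma>. \<sigma> \<in> space (\<mu> \<omega>) \<Longrightarrow> \<bar>h \<sigma>\<bar> \<le> B"
  shows "integrable (gibbs \<gamma> E (f \<omega>) (\<mu> \<omega>) y) h"
proof -
  interpret prob_space "gibbs \<gamma> E (f \<omega>) (\<mu> \<omega>) y"
    by (rule gibbs_prob_space[OF assms(1)])
  show ?thesis
    using assms(2,3) by (intro integrable_const_bound[where B = B] AE_I2)
      (auto simp: space_gibbs measurable_cong_sets[OF sets_gibbs refl])
qed

lemma avg_bound:
  fixes B :: real
  assumes "\<omega> \<in> space H" "h \<in> borel_measurable (\<mu> \<omega>)" "\<And>\<sigma>. \<sigma> \<in> space (\<mu> \<omega>) \<Longrightarrow> \<bar>h \<sigma>\<bar> \<le> B"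
  shows "\<bar>avg \<omega> y h\<bar> \<le> B"
proof -
  interpret prob_space "gibbs \<gamma> E (f \<omega>) (\<mu> \<omega>) y"
    by (rule gibbs_prob_space[OF assms(1)])
  have "\<bar>avg \<omega> y h\<bar> \<le> (\<integral>\<sigma>. \<bar>h \<sigma>\<bar> \<partial>gibbs \<gamma> E (f \<omega>) (\<mu> \<omega>) y)"
    unfolding gibbs_avg_def by (rule integral_abs_bound)
  also have "\<dots> \<le> B"
    using gibbs_integrable[OF assms] assms(3) by (intro integral_le_const integrable_abs AE_I2) (auto simp: space_gibbs)
  finally show ?thesis .
qed

text \<open>Differentiating the unnormalized integral multiplies the integrand by \<gamma> times
  \<open>f \<omega> e\<close>; the quotient rule then produces the Gibbs covariance.\<close>

lemma avg_has_derivative: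
  fixes B :: real
  assumes \<omega>: "\<omega> \<in> space H" and e: "e \<in> E"
    and h: "h \<in> borel_measurable (\<mu> \<omega>)" "\<And>\<sigma>. \<sigma> \<in> space (\<mu> \<omega>) \<Longrightarrow> \<bar>h \<sigma>\<bar> \<le> B"
  shows "((\<lambda>t. avg \<omega> (y(e := t)) h) has_real_derivative
    \<gamma> * (avg \<omega> (y(e := t)) (\<lambda>\<sigma>. f \<omega> e \<sigma> * h \<sigma>) - avg \<omega> (y(e := t)) (f \<omega> e) * avg \<omega> (y(e := t)) h)) (at t)"
proof -
  \<comment> \<open>\<open>r\<close> collects the part of the exponent that does not involve the
    coordinate \<open>e\<close>, so that the weight splits into a factor depending on
    \<open>t\<close> and a bounded factor that does not.\<close>
  define r where "r = (\<lambda>\<sigma>. \<gamma> * (\<Sum>e'\<in>E - {e}. y e' * f \<omega> e' \<sigma>))"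
  have r_measurable: "r \<in> borel_measurable (\<mu> \<omega>)"
    unfolding r_def using f_measurable_\<mu>[OF \<omega>] by (intro borel_measurable_times borel_measurable_sum) auto
  have r_bound: "\<bar>r \<sigma>\<bar> \<le> \<gamma> * (\<Sum>e'\<in>E - {e}. \<bar>y e'\<bar>)" if "\<sigma> \<in> space (\<mu> \<omega>)" for \<sigma>
    using weighted_sum_bound[OF \<omega> that, of "E - {e}" y] \<gamma>_pos by (simp add: r_def abs_mult)
  have weight: "exp (\<gamma> * energy E (f \<omega>) (y(e := t)) \<sigma>) = exp ((\<gamma> * t) * f \<omega> e \<sigma>) * exp (r \<sigma>)" for t \<sigma>
    using finite_E e by (simp add: energy_def r_def sum.remove[of E e] algebra_simps flip: exp_add)
  define n where "n = (\<lambda>g t. \<integral>\<sigma>. exp (\<gamma> * energy E (f \<omega>) (y(e := t)) \<sigma>) * g \<sigma> \<partial>\<mu> \<omega>)"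
  have n: "(n g has_real_derivative \<gamma> * n (\<lambda>\<sigma>. f \<omega> e \<sigma> * g \<sigma>) t) (at t)"
    if g: "g \<in> borel_measurable (\<mu> \<omega>)" "\<And>\<sigma>. \<sigma> \<in> space (\<mu> \<omega>) \<Longrightarrow> \<bar>g \<sigma>\<bar> \<le> D" for g :: "'s \<Rightarrow> real" and D :: real
  proof -
    \<comment> \<open>The rule for differentiating under the integral wants an exponent function
      bounded by 1. Hence \<gamma> is absorbed into the variable \<open>s\<close> and reappears
      through the chain rule.\<close>
    define N where "N = (\<lambda>s. \<integral>\<sigma>. exp (s * f \<omega> e \<sigma>) * (exp (r \<sigma>) * g \<sigma>) \<partial>\<mu> \<omega>)"
    define K where "K = exp (\<gamma> * (\<Sum>e'\<in>E - {e}. \<bar>y e'\<bar>)) * D"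
    have "\<bar>exp (r \<sigma>) * g \<sigma>\<bar> \<le> K" if "\<sigma> \<in> space (\<mu> \<omega>)" for \<sigma>
      using r_bound[OF that] g(2)[OF that] unfolding abs_mult K_def by (intro mult_mono) auto
    then have N: "(N has_real_derivative (\<integral>\<sigma>. exp (s * f \<omega> e \<sigma>) * (f \<omega> e \<sigma> * (exp (r \<sigma>) * g \<sigma>)) \<partial>\<mu> \<omega>)) (at s)" for s
      unfolding N_def using r_measurable g(1) f_range_\<mu>[OF \<omega> e]
      by (intro has_derivative_integral_exp[OF finite_\<mu>[OF \<omega>] f_measurable_\<mu>[OF \<omega> e]]) auto
    have nN: "n g = (\<lambda>t. N (\<gamma> * t))"
      unfolding n_def N_def weight by (simp add: mult.assoc)
    have n': "n (\<lambda>\<sigma>. f \<omega> e \<sigma> * g \<sigma>) t = (\<integral>\<sigma>. exp ((\<gamma> * t) * f \<omega> e \<sigma>) * (f \<omega> e \<sigma> * (exp (r \<sigma>) * g \<sigma>)) \<partial>\<mu> \<omega>)"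
      unfolding n_def weight by (simp add: ac_simps)
    have "((\<lambda>t. \<gamma> * t) has_real_derivative \<gamma>) (at t)"
      by (auto intro!: derivative_eq_intros)
    from DERIV_chain2[OF N[of "\<gamma> * t"] this] show ?thesis
      unfolding nN n'[unfolded nN] by (simp only: mult.commute)
  qed
  have avg: "avg \<omega> (y(e := t)) g = n g t / n (\<lambda>_. 1) t" if "g \<in> borel_measurable (\<mu> \<omega>)" for g t
    unfolding avg_eq[OF \<omega> that] n_def by (simp add: partition_fun_def)
  have pos: "n (\<lambda>_. 1) t > 0"
    using Z_pos[OF \<omega>, of "y(e := t)"] by (simp add: n_def partition_fun_def)
  have fe: "f \<omega> e \<in> borel_measurable (\<mu> \<omega>)"
    by (rule f_measurable_\<mu>[OF \<omega> e])
  have "((\<lambda>t. n h t / n (\<lambda>_. 1) t) has_real_derivative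
      (\<gamma> * n (\<lambda>\<sigma>. f \<omega> e \<sigma> * h \<sigma>) t * n (\<lambda>_. 1) t - n h t * (\<gamma> * n (f \<omega> e) t)) / (n (\<lambda>_. 1) t * n (\<lambda>_. 1) t)) (at t)"
    using n[OF h] n[of "\<lambda>_. 1" 1] pos by (intro DERIV_divide) auto
  also have "(\<lambda>t. n h t / n (\<lambda>_. 1) t) = (\<lambda>t. avg \<omega> (y(e := t)) h)"
    using avg[OF h(1)] by simp
  also have "(\<gamma> * n (\<lambda>\<sigma>. f \<omega> e \<sigma> * h \<sigma>) t * n (\<lambda>_. 1) t - n h t * (\<gamma> * n (f \<omega> e) t)) / (n (\<lambda>_. 1) t * n (\<lambda>_. 1) t)
     = \<gamma> * (avg \<omega> (y(e := t)) (\<lambda>\<sigma>. f \<omega> e \<sigma> * h \<sigma>) - avg \<omega> (y(e := t)) (f \<omega> e) * avg \<omega> (y(e := t)) h)"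
    unfolding avg[OF h(1)] avg[OF fe] avg[OF borel_measurable_times[OF fe h(1)]]
    using pos by (simp add: field_simps)
  finally show ?thesis .
qed

text \<open>Kernel measurability is available for subprobability measures, while \<mu> may have any
  finite mass. Dividing by the total mass does not change Gibbs averages, which are quotients of two
  integrals over \<mu>.\<close>

definition normalized :: "'w \<Rightarrow> 's measure" where
  "normalized \<omega> = density (\<mu> \<omega>) (\<lambda>_. ennreal (1 / measure (\<mu> \<omega>) (space S)))"

lemma normalized_measurable: "normalized \<in> H \<rightarrow>\<^sub>M subprob_algebra S"
proof (rule measurable_subprob_algebra)
  fix \<omega> assume \<omega>: "\<omega> \<in> space H"
  interpret finite_measure "\<mu> \<omega>" by (rule finite_\<mu>[OF \<omega>])
  have pos: "measure (\<mu> \<omega>) (space S) > 0"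
    using \<mu>_nonzero[OF \<omega>] by (simp add: measure_nonneg less_le emeasure_eq_measure)
  have "emeasure (normalized \<omega>) (space (normalized \<omega>)) = 1"
    using pos by (simp add: normalized_def emeasure_density_const space_\<mu>[OF \<omega>] emeasure_eq_measure
      sets_\<mu>[OF \<omega>] flip: ennreal_mult)
  then show "subprob_space (normalized \<omega>)"
    by (intro prob_space_imp_subprob_space prob_spaceI)
  show "sets (normalized \<omega>) = sets S"
    by (simp add: normalized_def sets_\<mu>[OF \<omega>])
next
  fix A assume A: "A \<in> sets S"
  note [measurable] = emeasure_\<mu>_measurable[OF A] emeasure_\<mu>_measurable[OF sets.top]
  have "(\<lambda>\<omega>. ennreal (1 / enn2real (emeasure (\<mu> \<omega>) (space S))) * emeasure (\<mu> \<omega>) A) \<in> borel_measurable H"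
    by measurable
  then show "(\<lambda>\<omega>. emeasure (normalized \<omega>) A) \<in> borel_measurable H"
    by (rule measurable_cong[THEN iffD1, rotated])
       (use A in \<open>simp add: normalized_def emeasure_density_const sets_\<mu> measure_def\<close>)
qed

lemma integral_normalized:
  assumes "\<omega> \<in> space H" "h \<in> borel_measurable (\<mu> \<omega>)"
  shows "(\<integral>\<sigma>. h \<sigma> \<partial>normalized \<omega>) = (\<integral>\<sigma>. h \<sigma> \<partial>\<mu> \<omega>) / measure (\<mu> \<omega>) (space S)"
  unfolding normalized_def by (subst integral_density) (use assms(2) in \<open>auto simp: measure_nonneg\<close>)

lemma weight_measurable:
  assumes h: "(\<lambda>(\<omega>, \<sigma>). h \<omega> \<sigma>) \<in> borel_measurable (H \<Otimes>\<^sub>M S)"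
  shows "(\<lambda>(x, \<sigma>). exp (\<gamma> * energy E (f (fst x)) (snd x) \<sigma>) * h (fst x) \<sigma>)
    \<in> borel_measurable ((H \<Otimes>\<^sub>M (\<Pi>\<^sub>M e\<in>E. borel)) \<Otimes>\<^sub>M S)"
proof -
  let ?B = "(H \<Otimes>\<^sub>M (\<Pi>\<^sub>M e\<in>E. borel :: real measure)) \<Otimes>\<^sub>M S"
  have proj: "(\<lambda>x. (fst (fst x), snd x)) \<in> ?B \<rightarrow>\<^sub>M H \<Otimes>\<^sub>M S"
    by measurable
  have F: "(\<lambda>x. f (fst (fst x)) e (snd x)) \<in> borel_measurable ?B" if "e \<in> E" for e
    using measurable_compose[OF proj f_measurable[OF that]] by simp
  have h': "(\<lambda>x. h (fst (fst x)) (snd x)) \<in> borel_measurable ?B"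
    using measurable_compose[OF proj h] by simp
  have Y: "(\<lambda>x. snd (fst x) e) \<in> borel_measurable ?B" if "e \<in> E" for e
    using measurable_compose[OF measurable_compose[OF measurable_fst measurable_snd]
      measurable_component_singleton[OF that]] .
  have "(\<lambda>x. \<Sum>e\<in>E. snd (fst x) e * f (fst (fst x)) e (snd x)) \<in> borel_measurable ?B"
    by (intro borel_measurable_sum borel_measurable_times F Y)
  then show ?thesis
    unfolding energy_def split_beta' using h' by (intro borel_measurable_times borel_measurable_exp borel_measurable_const) auto
qed

text \<open>Numerator and denominator are integrals against the normalized kernel; the total mass of
  \<mu>, positive and finite, cancels in the quotient.\<close>

lemma avg_measurable:
  assumes h: "(\<lambda>(\<omega>, \<sigma>). h \<omega> \<sigma>) \<in> borel_measurable (H \<Otimes>\<^sub>M S)"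
  shows "(\<lambda>(\<omega>, y). avg \<omega> y (h \<omega>)) \<in> borel_measurable (H \<Otimes>\<^sub>M (\<Pi>\<^sub>M e\<in>E. borel))"
proof -
  let ?B = "H \<Otimes>\<^sub>M (\<Pi>\<^sub>M e\<in>E. borel :: real measure)"
  let ?w = "\<lambda>x \<sigma>. exp (\<gamma> * energy E (f (fst x)) (snd x) \<sigma>)"
  have kernel: "(\<lambda>x. normalized (fst x)) \<in> ?B \<rightarrow>\<^sub>M subprob_algebra S"
    by (rule measurable_compose[OF measurable_fst normalized_measurable])
  have num: "(\<lambda>x. \<integral>\<sigma>. ?w x \<sigma> * h (fst x) \<sigma> \<partial>normalized (fst x)) \<in> borel_measurable ?B"
    by (rule borel_measurable_integral_kernel[OF weight_measurable[OF h] kernel])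
  have "(\<lambda>x. \<integral>\<sigma>. ?w x \<sigma> * 1 \<partial>normalized (fst x)) \<in> borel_measurable ?B"
    by (rule borel_measurable_integral_kernel[OF weight_measurable kernel]) simp
  with num have "(\<lambda>x. (\<integral>\<sigma>. ?w x \<sigma> * h (fst x) \<sigma> \<partial>normalized (fst x)) / (\<integral>\<sigma>. ?w x \<sigma> * 1 \<partial>normalized (fst x)))
      \<in> borel_measurable ?B"
    by (rule borel_measurable_divide)
  then show ?thesis
  proof (rule measurable_cong[THEN iffD1, rotated])
    fix x assume "x \<in> space ?B"
    then have \<omega>: "fst x \<in> space H"
      by (auto simp: space_pair_measure)
    interpret finite_measure "\<mu> (fst x)" by (rule finite_\<mu>[OF \<omega>])
    have pos: "measure (\<mu> (fst x)) (space S) > 0"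
      using \<mu>_nonzero[OF \<omega>] by (simp add: measure_nonneg less_le emeasure_eq_measure)
    have hx: "h (fst x) \<in> borel_measurable (\<mu> (fst x))"
      by (rule section_measurable[OF \<omega> h])
    have w: "?w x \<in> borel_measurable (\<mu> (fst x))"
      using energy_measurable[OF \<omega>, of "snd x"] by measurable
    show "(\<integral>\<sigma>. ?w x \<sigma> * h (fst x) \<sigma> \<partial>normalized (fst x)) / (\<integral>\<sigma>. ?w x \<sigma> * 1 \<partial>normalized (fst x))
      = (case x of (\<omega>, y) \<Rightarrow> avg \<omega> y (h \<omega>))"
      unfolding split_beta' avg_eq[OF \<omega> hx] partition_fun_def mult_1_right
        integral_normalized[OF \<omega> w] integral_normalized[OF \<omega> borel_measurable_times[OF w hx]]
      using pos by simp
  qed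
qed

text \<open>The algebra generated by the Gibbs moments of \<open>f e\<close> is closed under differentiation in the
  coordinate \<open>e\<close>, so all derivatives of \<open>\<langle>f e\<rangle>\<close> are bounded and jointly measurable.\<close>

inductive moment_poly :: "'e \<Rightarrow> ('w \<Rightarrow> ('e \<Rightarrow> real) \<Rightarrow> real) \<Rightarrow> bool" for e where
  moment: "moment_poly e (\<lambda>\<omega> y. avg \<omega> y (\<lambda>\<sigma>. f \<omega> e \<sigma> ^ n))"
| const: "moment_poly e (\<lambda>\<omega> y. c)"
| add: "moment_poly e A \<Longrightarrow> moment_poly e B \<Longrightarrow> moment_poly e (\<lambda>\<omega> y. A \<omega> y + B \<omega> y)"
| mult: "moment_poly e A \<Longrightarrow> moment_poly e B \<Longrightarrow> moment_poly e (\<lambda>\<omega> y. A \<omega> y * B \<omega> y)"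

lemma f_power_bound:
  "\<omega> \<in> space H \<Longrightarrow> e \<in> E \<Longrightarrow> \<sigma> \<in> space (\<mu> \<omega>) \<Longrightarrow> \<bar>f \<omega> e \<sigma> ^ n\<bar> \<le> 1"
  by (simp add: power_abs f_range_\<mu> power_le_one)

lemma f_power_measurable_\<mu>: "\<omega> \<in> space H \<Longrightarrow> e \<in> E \<Longrightarrow> (\<lambda>\<sigma>. f \<omega> e \<sigma> ^ n) \<in> borel_measurable (\<mu> \<omega>)"
  by (intro borel_measurable_power f_measurable_\<mu>)

lemma moment_poly_measurable:
  assumes "e \<in> E" "moment_poly e A"
  shows "(\<lambda>(\<omega>, y). A \<omega> y) \<in> borel_measurable (H \<Otimes>\<^sub>M (\<Pi>\<^sub>M e\<in>E. borel))"
  using assms(2)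
proof induction
  case (moment n)
  have "(\<lambda>x. (case x of (\<omega>, \<sigma>) \<Rightarrow> f \<omega> e \<sigma>) ^ n) \<in> borel_measurable (H \<Otimes>\<^sub>M S)"
    by (intro borel_measurable_power f_measurable assms(1))
  then show ?case
    by (intro avg_measurable) (simp add: split_beta')
next
  case (add A B)
  then show ?case
    using borel_measurable_add[OF add.IH] by (simp add: split_beta')
next
  case (mult A B)
  then show ?case
    using borel_measurable_times[OF mult.IH] by (simp add: split_beta')
qed simp

lemma moment_poly_bounded:
  assumes "e \<in> E" "moment_poly e A"
  shows "\<exists>B. \<forall>\<omega>\<in>space H. \<forall>y. \<bar>A \<omega> y\<bar> \<le> B"
  using assms(2)
proof induction
  case (moment n)
  show ?case
    using avg_bound[OF _ f_power_measurable_\<mu> f_power_bound] assms(1) by blast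
next
  case (const c)
  show ?case by blast
next
  case (add A B)
  then obtain a b where "\<forall>\<omega>\<in>space H. \<forall>y. \<bar>A \<omega> y\<bar> \<le> a" "\<forall>\<omega>\<in>space H. \<forall>y. \<bar>B \<omega> y\<bar> \<le> b"
    by blast
  then have "\<forall>\<omega>\<in>space H. \<forall>y. \<bar>A \<omega> y + B \<omega> y\<bar> \<le> a + b"
    by (meson abs_triangle_ineq add_mono order_trans)
  then show ?case by blast
next
  case (mult A B)
  then obtain a b where "\<forall>\<omega>\<in>space H. \<forall>y. \<bar>A \<omega> y\<bar> \<le> a" "\<forall>\<omega>\<in>space H. \<forall>y. \<bar>B \<omega> y\<bar> \<le> b"
    by blast
  then have "\<forall>\<omega>\<in>space H. \<forall>y. \<bar>A \<omega> y * B \<omega> y\<bar> \<le> a * b"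
    unfolding abs_mult by (meson abs_ge_zero mult_mono order_trans)
  then show ?case by blast
qed

text \<open>The n-th moment m_n has derivative \<gamma> (m_(n+1) - m_1 m_n), again in the algebra;
  sums and products follow from the usual rules.\<close>

lemma moment_poly_has_derivative:
  assumes "e \<in> E" "moment_poly e A"
  shows "\<exists>A'. moment_poly e A' \<and> (\<forall>\<omega>\<in>space H. \<forall>y t.
    ((\<lambda>t. A \<omega> (y(e := t))) has_real_derivative A' \<omega> (y(e := t))) (at t))"
  using assms(2)
proof induction
  case (moment n)
  let ?m = "\<lambda>n \<omega> y. avg \<omega> y (\<lambda>\<sigma>. f \<omega> e \<sigma> ^ n)"
  \<comment> \<open>The difference is written with the constant -1 because the generating rules
    offer only constants, sums and products.\<close>
  have "moment_poly e (\<lambda>\<omega> y. \<gamma> * (?m (Suc n) \<omega> y + (- 1) * (?m 1 \<omega> y * ?m n \<omega> y)))"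
    by (intro moment_poly.intros)
  moreover have "((\<lambda>t. ?m n \<omega> (y(e := t))) has_real_derivative
     \<gamma> * (?m (Suc n) \<omega> (y(e := t)) + (- 1) * (?m 1 \<omega> (y(e := t)) * ?m n \<omega> (y(e := t))))) (at t)"
    if "\<omega> \<in> space H" for \<omega> y t
    using avg_has_derivative[OF that assms(1) f_power_measurable_\<mu>[OF that assms(1)] f_power_bound[OF that assms(1)], where y = y and t = t]
    by simp
  ultimately show ?case by blast
next
  case (const c)
  have "moment_poly e (\<lambda>_ _. 0)"
    by (rule moment_poly.const)
  then show ?case by (intro exI[of _ "\<lambda>_ _. 0"]) auto
next
  case (add A B)
  then obtain A' B' where "moment_poly e A'" "moment_poly e B'"
    "\<forall>\<omega>\<in>space H. \<forall>y t. ((\<lambda>t. A \<omega> (y(e := t))) has_real_derivative A' \<omega> (y(e := t))) (at t)"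
    "\<forall>\<omega>\<in>space H. \<forall>y t. ((\<lambda>t. B \<omega> (y(e := t))) has_real_derivative B' \<omega> (y(e := t))) (at t)"
    by blast
  then show ?case
    by (intro exI[of _ "\<lambda>\<omega> y. A' \<omega> y + B' \<omega> y"] conjI moment_poly.add ballI allI DERIV_add) blast+
next
  case (mult A B)
  then obtain A' B' where "moment_poly e A'" "moment_poly e B'"
    "\<forall>\<omega>\<in>space H. \<forall>y t. ((\<lambda>t. A \<omega> (y(e := t))) has_real_derivative A' \<omega> (y(e := t))) (at t)"
    "\<forall>\<omega>\<in>space H. \<forall>y t. ((\<lambda>t. B \<omega> (y(e := t))) has_real_derivative B' \<omega> (y(e := t))) (at t)"
    by blast
  then show ?case
    using mult.hyps
    by (intro exI[of _ "\<lambda>\<omega> y. A' \<omega> y * B \<omega> y + B' \<omega> y * A \<omega> y"] conjI moment_poly.intros ballI allI DERIV_mult) blast+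
qed

text \<open>This is \<open>gibbs_deriv\<close> without the factor \<open>1 / \<gamma> ^ k\<close>,
  so that consecutive orders are derivatives of each other with no constant in between.\<close>

definition avg_deriv :: "nat \<Rightarrow> 'e \<Rightarrow> 'w \<Rightarrow> ('e \<Rightarrow> real) \<Rightarrow> real" where
  "avg_deriv k e \<omega> y = (deriv ^^ k) (\<lambda>t. avg \<omega> (y(e := t)) (f \<omega> e)) (y e)"

text \<open>The equation is between functions of \<open>t\<close>, not between values at one point,
  so that the next derivative can be taken in the induction. One \<open>A\<close> serves all
  \<omega> and \<open>y\<close>, which makes the resulting bounds uniform.\<close>

lemma avg_deriv_moment_poly:
  assumes "e \<in> E"
  shows "\<exists>A. moment_poly e A \<and> (\<forall>\<omega>\<in>space H. \<forall>y.
    (deriv ^^ k) (\<lambda>t. avg \<omega> (y(e := t)) (f \<omega> e)) = (\<lambda>t. A \<omega> (y(e := t))))"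
proof (induction k)
  case 0
  show ?case
    using moment_poly.moment[of e 1] by (intro exI conjI) auto
next
  case (Suc k)
  then obtain A where A: "moment_poly e A" "\<And>\<omega> y. \<omega> \<in> space H \<Longrightarrow>
      (deriv ^^ k) (\<lambda>t. avg \<omega> (y(e := t)) (f \<omega> e)) = (\<lambda>t. A \<omega> (y(e := t)))"
    by blast
  obtain A' where A': "moment_poly e A'" "\<And>\<omega> y t. \<omega> \<in> space H \<Longrightarrow>
      ((\<lambda>t. A \<omega> (y(e := t))) has_real_derivative A' \<omega> (y(e := t))) (at t)"
    using moment_poly_has_derivative[OF assms A(1)] by blast
  have "(deriv ^^ Suc k) (\<lambda>t. avg \<omega> (y(e := t)) (f \<omega> e)) = (\<lambda>t. A' \<omega> (y(e := t)))"
    if \<omega>: "\<omega> \<in> space H" for \<omega> y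
    unfolding funpow.simps o_def A(2)[OF \<omega>] by (rule ext, rule DERIV_imp_deriv[OF A'(2)[OF \<omega>]])
  then show ?case
    using A'(1) by blast
qed

lemma avg_deriv_eq_moment_poly:
  assumes "e \<in> E"
  obtains A where "moment_poly e A" "\<And>\<omega> y. \<omega> \<in> space H \<Longrightarrow> avg_deriv k e \<omega> y = A \<omega> y"
  using avg_deriv_moment_poly[OF assms, of k] unfolding avg_deriv_def by (metis fun_upd_triv)

lemma avg_deriv_0: "avg_deriv 0 e \<omega> y = avg \<omega> y (f \<omega> e)"
  by (simp add: avg_deriv_def)

lemma avg_deriv_measurable:
  assumes "e \<in> E"
  shows "(\<lambda>(\<omega>, y). avg_deriv k e \<omega> y) \<in> borel_measurable (H \<Otimes>\<^sub>M (\<Pi>\<^sub>M e\<in>E. borel))"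
proof -
  obtain A where A: "moment_poly e A" "\<And>\<omega> y. \<omega> \<in> space H \<Longrightarrow> avg_deriv k e \<omega> y = A \<omega> y"
    using avg_deriv_eq_moment_poly[OF assms] by blast
  show ?thesis
    using moment_poly_measurable[OF assms A(1)]
    by (rule measurable_cong[THEN iffD1, rotated]) (auto simp: A(2) space_pair_measure)
qed

lemma avg_deriv_bounded:
  assumes "e \<in> E"
  obtains B where "\<And>\<omega> y. \<omega> \<in> space H \<Longrightarrow> \<bar>avg_deriv k e \<omega> y\<bar> \<le> B"
proof -
  obtain A where A: "moment_poly e A" "\<And>\<omega> y. \<omega> \<in> space H \<Longrightarrow> avg_deriv k e \<omega> y = A \<omega> y"
    using avg_deriv_eq_moment_poly[OF assms] by blast
  then show ?thesis
    using that moment_poly_bounded[OF assms A(1)] by metis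
qed

text \<open>\<open>deriv\<close> by itself guarantees no differentiability; it is supplied by the
  representation through moments.\<close>

lemma avg_deriv_has_derivative:
  assumes "e \<in> E" "\<omega> \<in> space H"
  shows "((\<lambda>t. avg_deriv k e \<omega> (y(e := t))) has_real_derivative avg_deriv (Suc k) e \<omega> (y(e := t))) (at t)"
proof -
  obtain A where A: "moment_poly e A" "\<And>\<omega> y. \<omega> \<in> space H \<Longrightarrow>
      (deriv ^^ k) (\<lambda>t. avg \<omega> (y(e := t)) (f \<omega> e)) = (\<lambda>t. A \<omega> (y(e := t)))"
    using avg_deriv_moment_poly[OF assms(1)] by blast
  obtain A' where A': "\<And>y t. ((\<lambda>t. A \<omega> (y(e := t))) has_real_derivative A' \<omega> (y(e := t))) (at t)"
    using moment_poly_has_derivative[OF assms(1) A(1)] assms(2) by blast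
  show ?thesis
    using A'[of y t] by (simp add: avg_deriv_def A(2)[OF assms(2)] DERIV_imp_deriv[OF A'])
qed

end

section \<open>The Gibbs variance for fixed disorder\<close>

lemma measurable_section_gauss_PiM:
  assumes "\<omega> \<in> space H" "(\<lambda>(\<omega>, y). F \<omega> y) \<in> borel_measurable (H \<Otimes>\<^sub>M (\<Pi>\<^sub>M e\<in>E. borel))"
  shows "F \<omega> \<in> borel_measurable (gauss_PiM E)"
  using measurable_Pair2[OF assms(2,1)] unfolding measurable_cong_sets[OF sets_gauss_PiM refl] by simp

context gibbs_model
begin

section \<open>Gibbs covariances\<close>

definition cov :: "'w \<Rightarrow> 'e \<Rightarrow> 'e \<Rightarrow> ('e \<Rightarrow> real) \<Rightarrow> real" where
  "cov \<omega> e e' y = avg \<omega> y (\<lambda>\<sigma>. f \<omega> e \<sigma> * f \<omega> e' \<sigma>) - avg \<omega> y (f \<omega> e) * avg \<omega> y (f \<omega> e')"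

lemma f_mult_bound:
  "\<omega> \<in> space H \<Longrightarrow> e \<in> E \<Longrightarrow> e' \<in> E \<Longrightarrow> \<sigma> \<in> space (\<mu> \<omega>) \<Longrightarrow> \<bar>f \<omega> e \<sigma> * f \<omega> e' \<sigma>\<bar> \<le> 1"
  by (simp add: abs_mult f_range_\<mu> mult_le_one)

lemma f_mult_measurable_\<mu>:
  "\<omega> \<in> space H \<Longrightarrow> e \<in> E \<Longrightarrow> e' \<in> E \<Longrightarrow> (\<lambda>\<sigma>. f \<omega> e \<sigma> * f \<omega> e' \<sigma>) \<in> borel_measurable (\<mu> \<omega>)"
  by (intro borel_measurable_times f_measurable_\<mu>)

lemma cov_measurable:
  assumes "e \<in> E" "e' \<in> E"
  shows "(\<lambda>(\<omega>, y). cov \<omega> e e' y) \<in> borel_measurable (H \<Otimes>\<^sub>M (\<Pi>\<^sub>M e\<in>E. borel))"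
proof -
  have "(\<lambda>(\<omega>, \<sigma>). f \<omega> e \<sigma> * f \<omega> e' \<sigma>) \<in> borel_measurable (H \<Otimes>\<^sub>M S)"
    using borel_measurable_times[OF f_measurable[OF assms(1)] f_measurable[OF assms(2)]]
    by (simp add: split_beta')
  from avg_measurable[OF this] avg_measurable[OF f_measurable[OF assms(1)]] avg_measurable[OF f_measurable[OF assms(2)]]
  show ?thesis
    unfolding cov_def split_beta' by (intro borel_measurable_diff borel_measurable_times) auto
qed

lemma avg_f_bound: "\<omega> \<in> space H \<Longrightarrow> e \<in> E \<Longrightarrow> \<bar>avg \<omega> y (f \<omega> e)\<bar> \<le> 1"
  by (intro avg_bound f_measurable_\<mu> f_range_\<mu>)

lemma cov_bound:
  assumes "\<omega> \<in> space H" "e \<in> E" "e' \<in> E"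
  shows "\<bar>cov \<omega> e e' y\<bar> \<le> 2"
proof -
  have "\<bar>avg \<omega> y (\<lambda>\<sigma>. f \<omega> e \<sigma> * f \<omega> e' \<sigma>)\<bar> \<le> 1"
    using assms by (intro avg_bound f_mult_measurable_\<mu> f_mult_bound)
  moreover have "\<bar>avg \<omega> y (f \<omega> e) * avg \<omega> y (f \<omega> e')\<bar> \<le> 1"
    unfolding abs_mult using assms by (intro mult_le_one avg_f_bound) auto
  ultimately show ?thesis
    unfolding cov_def by linarith
qed

text \<open>The lower bound is the monotonicity of the average of \<open>f \<omega> e\<close> in its
  own coordinate, used for the first estimate. The upper bound 1 gives the term with
  \<open>fact k\<close> in the second one.\<close>

lemma cov_diag:
  assumes "\<omega> \<in> space H" "e \<in> E"
  shows "0 \<le> cov \<omega> e e y" "cov \<omega> e e y \<le> 1"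
proof -
  interpret prob_space "gibbs \<gamma> E (f \<omega>) (\<mu> \<omega>) y"
    by (rule gibbs_prob_space[OF assms(1)])
  have "integrable (gibbs \<gamma> E (f \<omega>) (\<mu> \<omega>) y) (f \<omega> e)"
    by (rule gibbs_integrable[OF assms(1) f_measurable_\<mu>[OF assms] f_range_\<mu>[OF assms]])
  moreover have "integrable (gibbs \<gamma> E (f \<omega>) (\<mu> \<omega>) y) (\<lambda>\<sigma>. (f \<omega> e \<sigma>)\<^sup>2)"
    by (rule gibbs_integrable[OF assms(1) f_power_measurable_\<mu>[OF assms] f_power_bound[OF assms]])
  ultimately have "variance (f \<omega> e) = cov \<omega> e e y"
    unfolding cov_def gibbs_avg_def power2_eq_square[symmetric] by (rule variance_eq)
  then show "0 \<le> cov \<omega> e e y"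
    using variance_positive[of "f \<omega> e"] by simp
  have "\<bar>avg \<omega> y (\<lambda>\<sigma>. f \<omega> e \<sigma> * f \<omega> e \<sigma>)\<bar> \<le> 1"
    using assms by (intro avg_bound f_mult_measurable_\<mu> f_mult_bound)
  then show "cov \<omega> e e y \<le> 1"
    unfolding cov_def using zero_le_square[of "avg \<omega> y (f \<omega> e)"] by linarith
qed

lemma avg_f_has_derivative:
  assumes "\<omega> \<in> space H" "e \<in> E" "e' \<in> E"
  shows "((\<lambda>t. avg \<omega> (y(e := t)) (f \<omega> e')) has_real_derivative \<gamma> * cov \<omega> e e' (y(e := t))) (at t)"
  unfolding cov_def
  by (rule avg_has_derivative[OF assms(1,2) f_measurable_\<mu>[OF assms(1,3)] f_range_\<mu>[OF assms(1,3)]])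

lemma cov_continuous:
  assumes "\<omega> \<in> space H" "e \<in> E" "e' \<in> E"
  shows "continuous_on UNIV (\<lambda>t. \<gamma> * cov \<omega> e e' (y(e := t)))"
proof -
  have "continuous_on UNIV (\<lambda>t. avg \<omega> (y(e := t)) h)"
    if "h \<in> borel_measurable (\<mu> \<omega>)" "\<And>\<sigma>. \<sigma> \<in> space (\<mu> \<omega>) \<Longrightarrow> \<bar>h \<sigma>\<bar> \<le> B" for h and B :: real
    by (rule DERIV_continuous_on, rule avg_has_derivative[OF assms(1,2) that])
  from this[OF f_mult_measurable_\<mu>[OF assms] f_mult_bound[OF assms]]
    this[OF f_measurable_\<mu>[OF assms(1,2)] f_range_\<mu>[OF assms(1,2)]]
    this[OF f_measurable_\<mu>[OF assms(1,3)] f_range_\<mu>[OF assms(1,3)]]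
  show ?thesis
    unfolding cov_def by (intro continuous_intros)
qed

lemma gibbs_var_expand:
  assumes \<omega>: "\<omega> \<in> space H"
  shows "gibbs_var \<gamma> E (f \<omega>) (\<mu> \<omega>) y (hermite_energy E a k (f \<omega>) y)
     = (\<Sum>e\<in>E. \<Sum>e'\<in>E. a e * a e' * (he k (y e) * he k (y e') * cov \<omega> e e' y))"
proof -
  let ?G = "gibbs \<gamma> E (f \<omega>) (\<mu> \<omega>) y"
  \<comment> \<open>For fixed \<open>y\<close> the Hermite values are mere coefficients, so the
    variance is a quadratic form in the Gibbs covariances.\<close>
  define b where "b = (\<lambda>e. a e * he k (y e))"
  have W: "hermite_energy E a k (f \<omega>) y = (\<lambda>\<sigma>. \<Sum>e\<in>E. b e * f \<omega> e \<sigma>)"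
    by (rule ext) (simp add: hermite_energy_def hermite_eq_poly b_def)
  have int1: "integrable ?G (\<lambda>\<sigma>. b e * f \<omega> e \<sigma>)" if "e \<in> E" for e
    by (intro integrable_mult_right gibbs_integrable[OF \<omega> f_measurable_\<mu>[OF \<omega> that] f_range_\<mu>[OF \<omega> that]])
  have int2: "integrable ?G (\<lambda>\<sigma>. b e * b e' * (f \<omega> e \<sigma> * f \<omega> e' \<sigma>))" if "e \<in> E" "e' \<in> E" for e e'
    by (intro integrable_mult_right gibbs_integrable[OF \<omega> f_mult_measurable_\<mu>[OF \<omega> that] f_mult_bound[OF \<omega> that]])
  have 1: "avg \<omega> y (\<lambda>\<sigma>. \<Sum>e\<in>E. b e * f \<omega> e \<sigma>) = (\<Sum>e\<in>E. b e * avg \<omega> y (f \<omega> e))"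
    unfolding gibbs_avg_def using int1 by (simp add: Bochner_Integration.integral_sum)
  have sq: "(\<Sum>e\<in>E. b e * f \<omega> e \<sigma>)\<^sup>2 = (\<Sum>e\<in>E. \<Sum>e'\<in>E. b e * b e' * (f \<omega> e \<sigma> * f \<omega> e' \<sigma>))" for \<sigma>
    unfolding power2_eq_square sum_product by (simp add: ac_simps)
  have 2: "avg \<omega> y (\<lambda>\<sigma>. (\<Sum>e\<in>E. b e * f \<omega> e \<sigma>)\<^sup>2)
      = (\<Sum>e\<in>E. \<Sum>e'\<in>E. b e * b e' * avg \<omega> y (\<lambda>\<sigma>. f \<omega> e \<sigma> * f \<omega> e' \<sigma>))"
    unfolding sq gibbs_avg_def using int2
    by (simp add: Bochner_Integration.integral_sum Bochner_Integration.integrable_sum)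
  have "gibbs_var \<gamma> E (f \<omega>) (\<mu> \<omega>) y (hermite_energy E a k (f \<omega>) y)
      = (\<Sum>e\<in>E. \<Sum>e'\<in>E. b e * b e' * cov \<omega> e e' y)"
  proof -
    have "(\<Sum>e\<in>E. b e * avg \<omega> y (f \<omega> e))\<^sup>2
        = (\<Sum>e\<in>E. \<Sum>e'\<in>E. b e * b e' * (avg \<omega> y (f \<omega> e) * avg \<omega> y (f \<omega> e')))"
      unfolding power2_eq_square sum_product by (simp add: ac_simps)
    then show ?thesis
      unfolding gibbs_var_def W 1 2 cov_def right_diff_distrib sum_subtractf by simp
  qed
  then show ?thesis
    by (simp add: b_def ac_simps)
qed

end

section \<open>Gaussian expectation of the Gibbs variance at frozen \<open>f\<close> and
  \<mu>\<close>

locale gibbs_realization = gibbs_model +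
  fixes \<omega> :: 'a
  assumes \<omega>: "\<omega> \<in> space H"
begin

abbreviation "P \<equiv> gauss_PiM E"

lemma cov_measurable_P: "e \<in> E \<Longrightarrow> e' \<in> E \<Longrightarrow> cov \<omega> e e' \<in> borel_measurable P"
  by (rule measurable_section_gauss_PiM[OF \<omega> cov_measurable])

lemma avg_measurable_P: "e \<in> E \<Longrightarrow> (\<lambda>y. avg \<omega> y (f \<omega> e)) \<in> borel_measurable P"
  by (rule measurable_section_gauss_PiM[OF \<omega> avg_measurable[OF f_measurable]])

lemma avg_deriv_measurable_P: "e \<in> E \<Longrightarrow> avg_deriv k e \<omega> \<in> borel_measurable P"
  by (rule measurable_section_gauss_PiM[OF \<omega> avg_deriv_measurable])

lemma integrable_poly_poly_cov:
  "e1 \<in> E \<Longrightarrow> e2 \<in> E \<Longrightarrow> e \<in> E \<Longrightarrow> e' \<in> E \<Longrightarrow> integrable P (\<lambda>y. poly p (y e1) * poly q (y e2) * cov \<omega> e e' y)"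
  by (rule integrable_mult_bounded[OF integrable_gauss_PiM_poly_poly cov_measurable_P cov_bound[OF \<omega>]])

lemma integrable_poly_poly_avg:
  "e1 \<in> E \<Longrightarrow> e2 \<in> E \<Longrightarrow> e \<in> E \<Longrightarrow> integrable P (\<lambda>y. poly p (y e1) * poly q (y e2) * avg \<omega> y (f \<omega> e))"
  by (rule integrable_mult_bounded[OF integrable_gauss_PiM_poly_poly avg_measurable_P avg_f_bound[OF \<omega>]])

text \<open>For \<open>e\<close> different from \<open>e'\<close> the factor
  \<open>he k (y e')\<close> is constant in the coordinate \<open>e\<close>, so the derivative falls
  on the Gibbs average alone.\<close>

lemma cov_off_diagonal_by_parts:
  assumes e: "e \<in> E" "e' \<in> E" "e \<noteq> e'"
  shows "\<gamma> * (\<integral>y. he k (y e) * he k (y e') * cov \<omega> e e' y \<partial>P)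
    = (\<integral>y. he (Suc k) (y e) * he k (y e') * avg \<omega> y (f \<omega> e') \<partial>P)"
proof -
  have "(\<integral>y. he k (y e') * poly ([:0, 1:] * hermite_poly k - pderiv (hermite_poly k)) (y e) * avg \<omega> y (f \<omega> e') \<partial>P)
    = (\<integral>y. he k (y e') * he k (y e) * (\<gamma> * cov \<omega> e e' y) \<partial>P)"
  proof (rule gauss_PiM_integral_by_parts[OF finite_E e(1)])
    show "he k ((y(e := t)) e') = he k (y e')" for y t
      using e(3) by simp
    show "\<bar>\<gamma> * cov \<omega> e e' y\<bar> \<le> \<gamma> * 2" for y
      using cov_bound[OF \<omega> e(1,2), of y] \<gamma>_pos by (simp add: abs_mult)
    show "\<bar>avg \<omega> y (f \<omega> e')\<bar> \<le> 1" for y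
      by (rule avg_f_bound[OF \<omega> e(2)])
    show "((\<lambda>t. avg \<omega> (y(e := t)) (f \<omega> e')) has_real_derivative \<gamma> * cov \<omega> e e' (y(e := t))) (at t)" for y t
      by (rule avg_f_has_derivative[OF \<omega> e(1,2)])
    show "continuous_on UNIV (\<lambda>t. \<gamma> * cov \<omega> e e' (y(e := t)))" for y
      by (rule cov_continuous[OF \<omega> e(1,2)])
  qed (intro e integrable_gauss_PiM_poly_poly avg_measurable_P borel_measurable_times borel_measurable_const
         cov_measurable_P)+
  then show ?thesis
    unfolding hermite_poly.simps(2)[symmetric] by (simp add: ac_simps)
qed

lemma cov_diagonal_by_parts:
  assumes e: "e \<in> E"
  shows "\<gamma> * (\<integral>y. he k (y e) * he k (y e) * cov \<omega> e e y \<partial>P)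
    = (\<integral>y. he (Suc k) (y e) * he k (y e) * avg \<omega> y (f \<omega> e) \<partial>P)
      - real k * (\<integral>y. he k (y e) * he (k - 1) (y e) * avg \<omega> y (f \<omega> e) \<partial>P)"
proof -
  \<comment> \<open>The adjoint operator sends H_k^2 to x H_k^2 - 2 H_k H_k' = H_(k+1) H_k - k H_k
    H_(k-1).\<close>
  let ?q = "hermite_poly k * hermite_poly k"
  have "(\<integral>y. 1 * poly ([:0, 1:] * ?q - pderiv ?q) (y e) * avg \<omega> y (f \<omega> e) \<partial>P)
    = (\<integral>y. 1 * poly ?q (y e) * (\<gamma> * cov \<omega> e e y) \<partial>P)"
  proof (rule gauss_PiM_integral_by_parts[OF finite_E e])
    show "integrable P (\<lambda>y. 1 * poly p (y e))" for p
      using integrable_gauss_PiM_poly[OF e, of p] by simp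
    show "\<bar>\<gamma> * cov \<omega> e e y\<bar> \<le> \<gamma> * 2" for y
      using cov_bound[OF \<omega> e e, of y] \<gamma>_pos by (simp add: abs_mult)
    show "\<bar>avg \<omega> y (f \<omega> e)\<bar> \<le> 1" for y
      by (rule avg_f_bound[OF \<omega> e])
    show "((\<lambda>t. avg \<omega> (y(e := t)) (f \<omega> e)) has_real_derivative \<gamma> * cov \<omega> e e (y(e := t))) (at t)" for y t
      by (rule avg_f_has_derivative[OF \<omega> e e])
    show "continuous_on UNIV (\<lambda>t. \<gamma> * cov \<omega> e e (y(e := t)))" for y
      by (rule cov_continuous[OF \<omega> e e])
  qed (intro refl e avg_measurable_P borel_measurable_times borel_measurable_const
         cov_measurable_P)+
  moreover have "poly ([:0, 1:] * ?q - pderiv ?q) x = he (Suc k) x * he k x - real k * (he k x * he (k - 1) x)" for x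
    by (simp add: pderiv_mult poly_pderiv_hermite_poly hermite_poly.simps(2) algebra_simps)
  ultimately have "(\<integral>y. he (Suc k) (y e) * he k (y e) * avg \<omega> y (f \<omega> e)
          - real k * (he k (y e) * he (k - 1) (y e) * avg \<omega> y (f \<omega> e)) \<partial>P)
      = (\<integral>y. \<gamma> * (he k (y e) * he k (y e) * cov \<omega> e e y) \<partial>P)"
    by (simp only: poly_mult mult_1_left left_diff_distrib mult.assoc mult.left_commute[of _ \<gamma>])
  then show ?thesis
    using integrable_poly_poly_avg[OF e e e] by simp
qed

text \<open>Since \<open>\<langle>f e\<rangle>\<close> is increasing in \<open>g e\<close>, the correction terms that appear when the derivative
  falls on \<open>he k (y e)\<close> have a favourable sign.\<close>

lemma cov_diagonal_le:
  assumes e: "e \<in> E"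
  shows "\<gamma> * (\<integral>y. he k (y e) * he k (y e) * cov \<omega> e e y \<partial>P)
    \<le> (\<integral>y. he (Suc k) (y e) * he k (y e) * avg \<omega> y (f \<omega> e) \<partial>P)"
proof -
  have nonneg: "0 \<le> \<gamma> * (\<integral>y. he k (y e) * he k (y e) * cov \<omega> e e y \<partial>P)" for k
    using mult_nonneg_nonneg[OF zero_le_square cov_diag(1)[OF \<omega> e]] \<gamma>_pos
    by (intro mult_nonneg_nonneg[of \<gamma>] Bochner_Integration.integral_nonneg) auto
  \<comment> \<open>Call this integral R_k. Integration by parts expresses it as a nonnegative
    covariance term plus k R_(k-1), so nonnegativity propagates upwards from k = 0.\<close>
  have R: "0 \<le> (\<integral>y. he (Suc k) (y e) * he k (y e) * avg \<omega> y (f \<omega> e) \<partial>P)" for k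
  proof (induction k)
    case 0
    then show ?case
      using cov_diagonal_by_parts[OF e, of 0] nonneg[of 0] by simp
  next
    case (Suc k)
    then have "0 \<le> real (Suc k) * (\<integral>y. he (Suc k) (y e) * he k (y e) * avg \<omega> y (f \<omega> e) \<partial>P)"
      by (intro mult_nonneg_nonneg) auto
    then show ?case
      using cov_diagonal_by_parts[OF e, of "Suc k"] nonneg[of "Suc k"] by simp
  qed
  show ?thesis
  proof (cases k)
    case 0
    then show ?thesis
      using cov_diagonal_by_parts[OF e, of 0] by simp
  next
    case (Suc j)
    have "0 \<le> real (Suc j) * (\<integral>y. he (Suc j) (y e) * he j (y e) * avg \<omega> y (f \<omega> e) \<partial>P)"
      by (intro mult_nonneg_nonneg R) auto
    then show ?thesis
      using cov_diagonal_by_parts[OF e, of k] Suc by simp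
  qed
qed

lemma gibbs_var_integrable_and_integral:
  shows "integrable P (\<lambda>y. gibbs_var \<gamma> E (f \<omega>) (\<mu> \<omega>) y (hermite_energy E a k (f \<omega>) y))"
    and "(\<integral>y. gibbs_var \<gamma> E (f \<omega>) (\<mu> \<omega>) y (hermite_energy E a k (f \<omega>) y) \<partial>P)
      = (\<Sum>e\<in>E. \<Sum>e'\<in>E. a e * a e' * (\<integral>y. he k (y e) * he k (y e') * cov \<omega> e e' y \<partial>P))"
proof -
  have int: "integrable P (\<lambda>y. a e * a e' * (he k (y e) * he k (y e') * cov \<omega> e e' y))" if "e \<in> E" "e' \<in> E" for e e'
    by (intro integrable_mult_right integrable_poly_poly_cov that)
  then show "integrable P (\<lambda>y. gibbs_var \<gamma> E (f \<omega>) (\<mu> \<omega>) y (hermite_energy E a k (f \<omega>) y))"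
    unfolding gibbs_var_expand[OF \<omega>] by (intro Bochner_Integration.integrable_sum)
  show "(\<integral>y. gibbs_var \<gamma> E (f \<omega>) (\<mu> \<omega>) y (hermite_energy E a k (f \<omega>) y) \<partial>P)
      = (\<Sum>e\<in>E. \<Sum>e'\<in>E. a e * a e' * (\<integral>y. he k (y e) * he k (y e') * cov \<omega> e e' y \<partial>P))"
    unfolding gibbs_var_expand[OF \<omega>] using int
    by (simp add: Bochner_Integration.integral_sum Bochner_Integration.integrable_sum)
qed

text \<open>Shared by both estimates: the weight \<open>g\<close> is the Gibbs average in the first
  and its k-th derivative in the second. The bound on \<open>g\<close> is required only almost
  everywhere, because the constant of the theorem bounds the derivative only almost surely.\<close>

lemma integral_hermite_sum_bound:
  fixes a :: "'c \<Rightarrow> real" and D :: real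
  assumes e: "e \<in> E" and I: "I \<subseteq> E"
    and g: "g \<in> borel_measurable P" "AE y in P. \<bar>g y\<bar> \<le> D" "0 \<le> D"
  shows "\<bar>\<integral>y. he j (y e) * (\<Sum>i\<in>I. a i * he (Suc k) (y i)) * g y \<partial>P\<bar>
    \<le> D * sqrt (fact j * (fact (Suc k) * (\<Sum>i\<in>I. (a i)\<^sup>2)))"
proof -
  define X where "X = (\<lambda>y. \<Sum>i\<in>I. a i * he (Suc k) (y i))"
  have hm: "(\<lambda>y. poly p (y i)) \<in> borel_measurable P" if "i \<in> E" for i p
    using integrable_gauss_PiM_poly[OF that] by (rule borel_measurable_integrable)
  have X: "X \<in> borel_measurable P"
    unfolding X_def using I by (intro borel_measurable_sum borel_measurable_times borel_measurable_const hm) auto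
  have h2: "integrable P (\<lambda>y. (he j (y e))\<^sup>2)"
    using integrable_gauss_PiM_poly[OF e, of "(hermite_poly j)\<^sup>2"] by simp
  have X2: "integrable P (\<lambda>y. (X y)\<^sup>2)" "(\<integral>y. (X y)\<^sup>2 \<partial>P) = fact (Suc k) * (\<Sum>i\<in>I. (a i)\<^sup>2)"
    unfolding X_def by (rule gauss_PiM_hermite_sum_square[OF finite_E I])+
  have int: "integrable P (\<lambda>y. D * \<bar>he j (y e) * X y\<bar>)"
    using integrable_mult_of_squares[OF hm[OF e] X h2 X2(1)] by (intro integrable_mult_right integrable_abs)
  have le: "AE y in P. \<bar>he j (y e) * X y * g y\<bar> \<le> D * \<bar>he j (y e) * X y\<bar>"
    using g(2)
  proof eventually_elim
    case (elim y)
    from mult_right_mono[OF elim, of "\<bar>he j (y e) * X y\<bar>"] show ?case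
      by (simp add: abs_mult mult.commute)
  qed
  have "\<bar>\<integral>y. he j (y e) * X y * g y \<partial>P\<bar> \<le> (\<integral>y. \<bar>he j (y e) * X y * g y\<bar> \<partial>P)"
    by (rule integral_abs_bound)
  also have "\<dots> \<le> (\<integral>y. D * \<bar>he j (y e) * X y\<bar> \<partial>P)"
  proof (rule integral_mono_AE[OF _ int le], rule Bochner_Integration.integrable_bound[OF int])
    show "(\<lambda>y. \<bar>he j (y e) * X y * g y\<bar>) \<in> borel_measurable P"
      by (intro borel_measurable_abs borel_measurable_times hm e X g(1))
    show "AE y in P. norm \<bar>he j (y e) * X y * g y\<bar> \<le> norm (D * \<bar>he j (y e) * X y\<bar>)"
      using le g(3) by simp
  qed
  also have "\<dots> = D * (\<integral>y. \<bar>he j (y e) * X y\<bar> \<partial>P)"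
    by (rule integral_mult_right_zero)
  also have "\<dots> \<le> D * sqrt ((\<integral>y. (he j (y e))\<^sup>2 \<partial>P) * (\<integral>y. (X y)\<^sup>2 \<partial>P))"
    by (intro mult_left_mono integral_abs_mult_le_sqrt hm e X h2 X2(1) g(3))
  also have "\<dots> = D * sqrt (fact j * (fact (Suc k) * (\<Sum>i\<in>I. (a i)\<^sup>2)))"
    by (simp only: X2(2) gauss_PiM_hermite_square[OF finite_E e])
  finally show ?thesis
    unfolding X_def .
qed

lemma integral_gibbs_var_le:
  "\<gamma> * (\<integral>y. gibbs_var \<gamma> E (f \<omega>) (\<mu> \<omega>) y (hermite_energy E a k (f \<omega>) y) \<partial>P)
    \<le> sqrt (fact k * fact (k + 1)) * (\<Sum>e\<in>E. \<bar>a e\<bar>) * L2_set a E"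
proof -
  define U where "U = (\<lambda>e e'. \<integral>y. he (Suc k) (y e) * he k (y e') * avg \<omega> y (f \<omega> e') \<partial>P)"
  \<comment> \<open>On the diagonal there is only an inequality, which is enough because the
    coefficient is a square. Off the diagonal the coefficient can be negative, and equality is
    needed.\<close>
  have T: "\<gamma> * (a e * a e' * (\<integral>y. he k (y e) * he k (y e') * cov \<omega> e e' y \<partial>P)) \<le> a e * a e' * U e e'"
    if "e \<in> E" "e' \<in> E" for e e'
  proof (cases "e = e'")
    case True
    have "(a e * a e) * (\<gamma> * (\<integral>y. he k (y e) * he k (y e) * cov \<omega> e e y \<partial>P)) \<le> (a e * a e) * U e e"
      unfolding U_def using that by (intro mult_left_mono cov_diagonal_le) auto
    then show ?thesis
      using True by (simp add: ac_simps)
  next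
    case False
    then show ?thesis
      using cov_off_diagonal_by_parts[OF that False, of k] unfolding U_def by (simp add: mult.left_commute[of \<gamma>])
  qed
  have U: "(\<Sum>e\<in>E. a e * a e' * U e e') \<le> \<bar>a e'\<bar> * (sqrt (fact k * fact (k + 1)) * L2_set a E)"
    if e': "e' \<in> E" for e'
  proof -
    \<comment> \<open>All first indices are gathered, for fixed \<open>e'\<close>, before anything
      is estimated. The weight is bounded by 1, hence the factor 1 below.\<close>
    define V where "V = (\<integral>y. he k (y e') * (\<Sum>i\<in>E. a i * he (Suc k) (y i)) * avg \<omega> y (f \<omega> e') \<partial>P)"
    have eq: "he k (y e') * (\<Sum>i\<in>E. a i * he (Suc k) (y i)) * avg \<omega> y (f \<omega> e')
        = (\<Sum>i\<in>E. a i * (he (Suc k) (y i) * he k (y e') * avg \<omega> y (f \<omega> e')))" for y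
      unfolding sum_distrib_left sum_distrib_right by (simp add: ac_simps)
    have "V = (\<Sum>i\<in>E. a i * U i e')"
      unfolding V_def U_def eq using integrable_poly_poly_avg[OF _ e' e']
      by (simp add: Bochner_Integration.integral_sum)
    then have "(\<Sum>e\<in>E. a e * a e' * U e e') = a e' * V"
      by (simp add: sum_distrib_left ac_simps)
    also have "\<dots> \<le> \<bar>a e'\<bar> * \<bar>V\<bar>"
      by (simp add: abs_mult[symmetric])
    also have "\<dots> \<le> \<bar>a e'\<bar> * (1 * sqrt (fact k * (fact (Suc k) * (\<Sum>i\<in>E. (a i)\<^sup>2))))"
      unfolding V_def using avg_f_bound[OF \<omega> e']
      by (intro mult_left_mono integral_hermite_sum_bound e' order_refl avg_measurable_P) auto
    finally show ?thesis
      by (simp add: L2_set_def real_sqrt_mult)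
  qed
  have "\<gamma> * (\<integral>y. gibbs_var \<gamma> E (f \<omega>) (\<mu> \<omega>) y (hermite_energy E a k (f \<omega>) y) \<partial>P)
      \<le> (\<Sum>e\<in>E. \<Sum>e'\<in>E. a e * a e' * U e e')"
    unfolding gibbs_var_integrable_and_integral(2) sum_distrib_left by (intro sum_mono T)
  also have "\<dots> = (\<Sum>e'\<in>E. \<Sum>e\<in>E. a e * a e' * U e e')"
    by (rule sum.swap)
  also have "\<dots> \<le> (\<Sum>e'\<in>E. \<bar>a e'\<bar> * (sqrt (fact k * fact (k + 1)) * L2_set a E))"
    by (intro sum_mono U)
  also have "\<dots> = sqrt (fact k * fact (k + 1)) * (\<Sum>e\<in>E. \<bar>a e\<bar>) * L2_set a E"
    unfolding sum_distrib_right[symmetric] by simp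
  finally show ?thesis .
qed

text \<open>Each integration by parts in \<open>y e'\<close> lowers the Hermite degree and raises
  the order of the derivative, while \<open>he k (y e)\<close> stays constant. The order
  \<open>j\<close> is general to carry the induction.\<close>

lemma integral_hermite_avg_deriv:
  assumes e: "e \<in> E" "e' \<in> E" "e \<noteq> e'"
  shows "(\<integral>y. he k (y e) * he m (y e') * avg_deriv j e' \<omega> y \<partial>P) = (\<integral>y. he k (y e) * avg_deriv (j + m) e' \<omega> y \<partial>P)"
proof (induction m arbitrary: j)
  case (Suc m)
  obtain B where B: "\<And>y. \<bar>avg_deriv j e' \<omega> y\<bar> \<le> B"
    using avg_deriv_bounded[OF e(2)] \<omega> by metis
  obtain B' where B': "\<And>y. \<bar>avg_deriv (Suc j) e' \<omega> y\<bar> \<le> B'"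
    using avg_deriv_bounded[OF e(2)] \<omega> by metis
  have "(\<integral>y. he k (y e) * poly ([:0, 1:] * hermite_poly m - pderiv (hermite_poly m)) (y e') * avg_deriv j e' \<omega> y \<partial>P)
    = (\<integral>y. he k (y e) * he m (y e') * avg_deriv (Suc j) e' \<omega> y \<partial>P)"
  proof (rule gauss_PiM_integral_by_parts[OF finite_E e(2) _ _ _ _ B B'])
    show "he k ((y(e' := t)) e) = he k (y e)" for y t
      using e(3) by simp
    show "((\<lambda>t. avg_deriv j e' \<omega> (y(e' := t))) has_real_derivative avg_deriv (Suc j) e' \<omega> (y(e' := t))) (at t)" for y t
      by (rule avg_deriv_has_derivative[OF e(2) \<omega>])
    show "continuous_on UNIV (\<lambda>t. avg_deriv (Suc j) e' \<omega> (y(e' := t)))" for y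
      by (rule DERIV_continuous_on, rule avg_deriv_has_derivative[OF e(2) \<omega>])
  qed (intro e integrable_gauss_PiM_poly_poly avg_deriv_measurable_P)+
  then show ?case
    unfolding hermite_poly.simps(2)[symmetric] Suc.IH by simp
qed simp

lemma integral_hermite_sq_cov_le:
  assumes e: "e \<in> E"
  shows "(\<integral>y. he k (y e) * he k (y e) * cov \<omega> e e y \<partial>P) \<le> fact k"
proof -
  have "(\<integral>y. he k (y e) * he k (y e) * cov \<omega> e e y \<partial>P) \<le> (\<integral>y. he k (y e) * he k (y e) \<partial>P)"
  proof (rule integral_mono)
    show "integrable P (\<lambda>y. he k (y e) * he k (y e) * cov \<omega> e e y)"
      by (intro integrable_poly_poly_cov e)
    show "integrable P (\<lambda>y. he k (y e) * he k (y e))"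
      by (intro integrable_gauss_PiM_poly_poly e)
    show "he k (y e) * he k (y e) * cov \<omega> e e y \<le> he k (y e) * he k (y e)" for y
      by (rule mult_left_le[OF cov_diag(2)[OF \<omega> e] zero_le_square])
  qed
  also have "\<dots> = fact k"
    using gauss_PiM_hermite_square[OF finite_E e, of k] by (simp only: power2_eq_square)
  finally show ?thesis .
qed

text \<open>\<open>C\<close> bounds the unscaled derivative. With \<open>C * \<gamma> ^ k\<close> in
  its place, division by the factor \<gamma> on the left leaves the exponent \<open>k - 1\<close> of
  the theorem.\<close>

lemma integral_gibbs_var_le_deriv:
  fixes C :: real
  assumes C: "AE y in P. \<forall>e\<in>E. \<bar>avg_deriv k e \<omega> y\<bar> \<le> C" "0 \<le> C"
  shows "\<gamma> * (\<integral>y. gibbs_var \<gamma> E (f \<omega>) (\<mu> \<omega>) y (hermite_energy E a k (f \<omega>) y) \<partial>P)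
    \<le> C * sqrt (fact (k + 1)) * (\<Sum>e\<in>E. \<bar>a e\<bar>) * L2_set a E + \<gamma> * (fact k * (L2_set a E)\<^sup>2)"
proof -
  define T where "T = (\<lambda>e e'. \<integral>y. he k (y e) * he k (y e') * cov \<omega> e e' y \<partial>P)"
  define U where "U = (\<lambda>e e'. \<integral>y. he (Suc k) (y e) * avg_deriv k e' \<omega> y \<partial>P)"
  have T: "\<gamma> * T e e' = U e e'" if "e \<in> E" "e' \<in> E" "e \<noteq> e'" for e e'
    using cov_off_diagonal_by_parts[OF that, of k] integral_hermite_avg_deriv[OF that, of "Suc k" k 0]
    by (simp add: T_def U_def avg_deriv_0)
  have diag: "T e e \<le> fact k" if "e \<in> E" for e
    unfolding T_def by (rule integral_hermite_sq_cov_le[OF that])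
  have U: "(\<Sum>e\<in>E - {e'}. a e * a e' * (\<gamma> * T e e')) \<le> \<bar>a e'\<bar> * (C * sqrt (fact (k + 1)) * L2_set a E)"
    if e': "e' \<in> E" for e'
  proof -
    \<comment> \<open>The factor \<open>he 0 (y e')\<close> equals 1; it only brings the integral
      into the form of \<open>integral_hermite_sum_bound\<close> and contributes
      \<open>fact 0\<close>.\<close>
    define V where "V = (\<integral>y. he 0 (y e') * (\<Sum>i\<in>E - {e'}. a i * he (Suc k) (y i)) * avg_deriv k e' \<omega> y \<partial>P)"
    have AE: "AE y in P. \<bar>avg_deriv k e' \<omega> y\<bar> \<le> C"
      using C(1) by eventually_elim (use e' in auto)
    obtain B where B: "\<And>y. \<bar>avg_deriv k e' \<omega> y\<bar> \<le> B"
      using avg_deriv_bounded[OF e'] \<omega> by metis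
    have int: "integrable P (\<lambda>y. he (Suc k) (y i) * avg_deriv k e' \<omega> y)" if "i \<in> E" for i
      by (rule integrable_mult_bounded[OF integrable_gauss_PiM_poly[OF that] avg_deriv_measurable_P[OF e'] B])
    have eq: "he 0 (y e') * (\<Sum>i\<in>E - {e'}. a i * he (Suc k) (y i)) * avg_deriv k e' \<omega> y
        = (\<Sum>i\<in>E - {e'}. a i * (he (Suc k) (y i) * avg_deriv k e' \<omega> y))" for y
      unfolding sum_distrib_left sum_distrib_right by (simp add: ac_simps)
    have "V = (\<Sum>i\<in>E - {e'}. a i * U i e')"
      unfolding V_def U_def eq using int by (simp add: Bochner_Integration.integral_sum)
    then have "(\<Sum>e\<in>E - {e'}. a e * a e' * (\<gamma> * T e e')) = a e' * V"
      using T[OF _ e'] by (simp add: sum_distrib_left ac_simps)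
    also have "\<dots> \<le> \<bar>a e'\<bar> * \<bar>V\<bar>"
      by (simp add: abs_mult[symmetric])
    also have "\<dots> \<le> \<bar>a e'\<bar> * (C * sqrt (fact 0 * (fact (Suc k) * (\<Sum>i\<in>E - {e'}. (a i)\<^sup>2))))"
      unfolding V_def by (intro mult_left_mono integral_hermite_sum_bound e' avg_deriv_measurable_P AE C(2)) auto
    \<comment> \<open>Restoring the omitted index adds a square under the root.\<close>
    also have "\<dots> \<le> \<bar>a e'\<bar> * (C * sqrt (fact 0 * (fact (Suc k) * (\<Sum>i\<in>E. (a i)\<^sup>2))))"
      using finite_E by (intro mult_left_mono C(2) real_sqrt_le_mono sum_mono2) auto
    finally show ?thesis
      by (simp add: L2_set_def real_sqrt_mult ac_simps)
  qed
  have "\<gamma> * (\<integral>y. gibbs_var \<gamma> E (f \<omega>) (\<mu> \<omega>) y (hermite_energy E a k (f \<omega>) y) \<partial>P)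
      = (\<Sum>e\<in>E. \<Sum>e'\<in>E. a e * a e' * (\<gamma> * T e e'))"
    unfolding gibbs_var_integrable_and_integral(2) T_def sum_distrib_left by (intro sum.cong refl mult.left_commute)
  also have "\<dots> = (\<Sum>e'\<in>E. \<Sum>e\<in>E. a e * a e' * (\<gamma> * T e e'))"
    by (rule sum.swap)
  also have "\<dots> = (\<Sum>e'\<in>E. a e' * a e' * (\<gamma> * T e' e') + (\<Sum>e\<in>E - {e'}. a e * a e' * (\<gamma> * T e e')))"
    using finite_E by (intro sum.cong refl sum.remove)
  also have "\<dots> \<le> (\<Sum>e'\<in>E. a e' * a e' * (\<gamma> * fact k) + \<bar>a e'\<bar> * (C * sqrt (fact (k + 1)) * L2_set a E))"
    using \<gamma>_pos by (intro sum_mono add_mono U mult_left_mono diag) auto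
  also have "\<dots> = C * sqrt (fact (k + 1)) * (\<Sum>e\<in>E. \<bar>a e\<bar>) * L2_set a E + \<gamma> * (fact k * (\<Sum>e\<in>E. (a e)\<^sup>2))"
    unfolding sum.distrib sum_distrib_right[symmetric] power2_eq_square[symmetric] by (simp add: ac_simps)
  also have "(\<Sum>e\<in>E. (a e)\<^sup>2) = (L2_set a E)\<^sup>2"
    by (simp add: L2_set_def sum_nonneg)
  finally show ?thesis .
qed

end

section \<open>Averaging over the disorder\<close>

text \<open>The product measure lives on functions that are undefined outside \<open>E\<close>,
  whereas the theorem evaluates \<open>g\<close> at arbitrary indices; the congruence rules allow
  passing to the restriction.\<close>

lemma energy_cong:
  "(\<And>e. e \<in> E \<Longrightarrow> y e = y' e) \<Longrightarrow> energy E f y = energy E f y'"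
  unfolding energy_def by (intro ext sum.cong) auto

lemma gibbs_cong:
  "(\<And>e. e \<in> E \<Longrightarrow> y e = y' e) \<Longrightarrow> gibbs \<gamma> E f \<mu> y = gibbs \<gamma> E f \<mu> y'"
  unfolding gibbs_def partition_fun_def using energy_cong[of E y y' f] by simp

lemma gibbs_var_hermite_energy_cong:
  assumes "\<And>e. e \<in> E \<Longrightarrow> y e = y' e"
  shows "gibbs_var \<gamma> E f \<mu> y (hermite_energy E a k f y) = gibbs_var \<gamma> E f \<mu> y' (hermite_energy E a k f y')"
proof -
  have "hermite_energy E a k f y = hermite_energy E a k f y'"
    unfolding hermite_energy_def using assms by (intro ext sum.cong) auto
  then show ?thesis
    unfolding gibbs_var_def gibbs_avg_def using gibbs_cong[of E y y' \<gamma> f \<mu>] assms by simp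
qed

lemma gibbs_deriv_cong:
  assumes "\<And>e. e \<in> E \<Longrightarrow> y e = y' e" "e \<in> E"
  shows "gibbs_deriv \<gamma> E f \<mu> k e y = gibbs_deriv \<gamma> E f \<mu> k e y'"
proof -
  have "gibbs \<gamma> E f \<mu> (y(e := t)) = gibbs \<gamma> E f \<mu> (y'(e := t))" for t
    using assms(1) by (intro gibbs_cong) auto
  then show ?thesis
    unfolding gibbs_deriv_def gibbs_avg_def using assms by simp
qed

text \<open>\<open>avg_measurable\<close> covers integrands that do not depend on \<open>y\<close>,
  but \<open>hermite_energy\<close> does. The expansion into covariances moves this dependence into
  coefficients.\<close>

lemma (in gibbs_model) gibbs_var_measurable:
  "(\<lambda>(\<omega>, y). gibbs_var \<gamma> E (f \<omega>) (\<mu> \<omega>) y (hermite_energy E a k (f \<omega>) y))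
     \<in> borel_measurable (H \<Otimes>\<^sub>M (\<Pi>\<^sub>M e\<in>E. borel))"
proof -
  let ?B = "H \<Otimes>\<^sub>M (\<Pi>\<^sub>M e\<in>E. borel :: real measure)"
  have Y: "(\<lambda>x. he k (snd x e)) \<in> borel_measurable ?B" if "e \<in> E" for e
    using measurable_compose[OF measurable_compose[OF measurable_snd measurable_component_singleton[OF that]] borel_measurable_poly] .
  have "(\<lambda>x. cov (fst x) e e' (snd x)) \<in> borel_measurable ?B" if "e \<in> E" "e' \<in> E" for e e'
    using cov_measurable[OF that] by (simp add: split_beta')
  then have "(\<lambda>x. \<Sum>e\<in>E. \<Sum>e'\<in>E. a e * a e' * (he k (snd x e) * he k (snd x e') * cov (fst x) e e' (snd x)))
      \<in> borel_measurable ?B"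
    by (intro borel_measurable_sum borel_measurable_times borel_measurable_const Y)
  then show ?thesis
    by (rule measurable_cong[THEN iffD1, rotated]) (auto simp: space_pair_measure gibbs_var_expand)
qed

theorem theorem6:
  fixes M :: "'w measure" and H :: "'w measure" and S :: "'s measure"
    and E :: "'e set" and g :: "'e \<Rightarrow> 'w \<Rightarrow> real"
    and f :: "'w \<Rightarrow> 'e \<Rightarrow> 's \<Rightarrow> real" and \<mu> :: "'w \<Rightarrow> 's measure"
    and \<gamma> :: real and a :: "'e \<Rightarrow> real" and k :: nat
  assumes "prob_space M"
    and "finite E"
    and "\<gamma> > 0"
    and g_indep: "prob_space.indep_vars M (\<lambda>_. borel) g E"
    and g_normal: "\<And>e. e \<in> E \<Longrightarrow> distributed M lborel (g e) std_normal_density"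
    \<comment> \<open>\<open>H\<close> carries the randomness of \<open>f\<close> and \<open>\<mu>\<close>\<close>
    and H_sub: "subalgebra M H"
    and H_indep: "prob_space.indep_set M (sets H)
      (sets (vimage_algebra (space M) (\<lambda>\<omega>. \<lambda>e\<in>E. g e \<omega>) (\<Pi>\<^sub>M e\<in>E. borel)))"
    and f_measurable:
      "\<And>e. e \<in> E \<Longrightarrow> (\<lambda>(\<omega>, \<sigma>). f \<omega> e \<sigma>) \<in> borel_measurable (H \<Otimes>\<^sub>M S)"
    and f_range:
      "\<And>\<omega> e \<sigma>. \<omega> \<in> space M \<Longrightarrow> e \<in> E \<Longrightarrow> \<sigma> \<in> space S \<Longrightarrow> f \<omega> e \<sigma> \<in> {-1..1}"
    and mu: "random_finite_measure H S \<mu>"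
  shows "prob_space.expectation M
           (\<lambda>\<omega>. gibbs_var \<gamma> E (f \<omega>) (\<mu> \<omega>) (\<lambda>e. g e \<omega>)
                  (hermite_energy E a k (f \<omega>) (\<lambda>e. g e \<omega>)))
         \<le> sqrt (fact k * fact (k + 1)) / \<gamma> * (\<Sum>e\<in>E. \<bar>a e\<bar>) * L2_set a E
       \<and> (k \<ge> 1 \<longrightarrow> (\<forall>C :: real.
           (AE \<omega> in M. \<forall>e\<in>E. \<bar>gibbs_deriv \<gamma> E (f \<omega>) (\<mu> \<omega>) k e (\<lambda>e'. g e' \<omega>)\<bar> \<le> C) \<longrightarrow>
           prob_space.expectation M
             (\<lambda>\<omega>. gibbs_var \<gamma> E (f \<omega>) (\<mu> \<omega>) (\<lambda>e. g e \<omega>)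
                    (hermite_energy E a k (f \<omega>) (\<lambda>e. g e \<omega>)))
           \<le> C * sqrt (fact (k + 1)) * \<gamma> ^ (k - 1) * (\<Sum>e\<in>E. \<bar>a e\<bar>) * L2_set a E
              + fact k * (L2_set a E)\<^sup>2))"
proof (cases "E = {}")
  \<comment> \<open>Both bounds read 0 \<le> 0 here. A nonempty \<open>E\<close> is used below for
    the product law and for the sign of \<open>C\<close>.\<close>
  case True
  then show ?thesis
    by (simp add: gibbs_var_def gibbs_avg_def hermite_energy_def)
next
  case False
  interpret prob_space M by fact
  have space_H: "space H = space M" and sets_H: "sets H \<subseteq> sets M"
    using H_sub by (auto simp: subalgebra_def)
  have "gibbs_model H S E f \<mu> \<gamma>"
    using assms(2,3) f_measurable f_range mu
    by unfold_locales (auto simp: space_H abs_le_iff minus_le_iff)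
  then interpret gibbs_model H S E f \<mu> \<gamma> .
  define G where "G = (\<lambda>\<omega>. \<lambda>e\<in>E. g e \<omega>)"
  let ?PB = "\<Pi>\<^sub>M e\<in>E. borel :: real measure"
  let ?P = "gauss_PiM E"
  have rv: "random_variable borel (g e)" if "e \<in> E" for e
    using distributed_measurable[OF g_normal[OF that]] by simp
  have G_measurable: "G \<in> M \<rightarrow>\<^sub>M ?PB"
    unfolding G_def by (rule measurable_restrict[OF rv])
  have id_measurable: "(\<lambda>\<omega>. \<omega>) \<in> M \<rightarrow>\<^sub>M H"
    using measurable_from_subalg[OF H_sub, of "\<lambda>\<omega>. \<omega>" H] by simp

  have "distr M borel (g e) = std_gauss" if "e \<in> E" for e
  proof -
    have "distr M borel (g e) = distr M lborel (g e)"
      by (rule distr_cong) auto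
    then show ?thesis
      using distributed_distr_eq_density[OF g_normal[OF that]] by (simp add: std_gauss_def)
  qed
  then have law_G: "distr M ?PB G = ?P"
    using indep_vars_iff_distr_eq_PiM'[OF False rv] g_indep
    unfolding gauss_PiM_def G_def by (simp cong: PiM_cong)

  \<comment> \<open>\<open>R\<close> is the probability of \<open>M\<close> seen on the smaller
    sigma-algebra \<open>H\<close>, that is, the law of the disorder other than the
    Gaussians.\<close>
  define R where "R = distr M H (\<lambda>\<omega>. \<omega>)"
  interpret R: prob_space R
    unfolding R_def by (rule prob_space_distr[OF id_measurable])
  interpret P: prob_space ?P
    by (rule prob_space_gauss_PiM)
  interpret RP: pair_sigma_finite R ?P ..
  have space_R: "space R = space H"
    by (simp add: R_def)
  have pair_measurable: "(\<lambda>\<omega>. (\<omega>, G \<omega>)) \<in> M \<rightarrow>\<^sub>M H \<Otimes>\<^sub>M ?PB"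
    using id_measurable G_measurable by (rule measurable_Pair)
  \<comment> \<open>This is independence in the form needed for Fubini: the pair of \<omega>, seen
    through \<open>H\<close>, and the Gaussian vector has a product law. Rectangles suffice.\<close>
  have joint: "R \<Otimes>\<^sub>M ?P = distr M (H \<Otimes>\<^sub>M ?PB) (\<lambda>\<omega>. (\<omega>, G \<omega>))"
  proof (rule pair_measure_eqI)
    show "sigma_finite_measure R" "sigma_finite_measure ?P"
      by unfold_locales
    show "sets (R \<Otimes>\<^sub>M ?P) = sets (distr M (H \<Otimes>\<^sub>M ?PB) (\<lambda>\<omega>. (\<omega>, G \<omega>)))"
      unfolding sets_distr by (rule sets_pair_measure_cong) (simp_all add: R_def sets_gauss_PiM)
    fix A B assume A: "A \<in> sets R" and B: "B \<in> sets ?P"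
    then have A': "A \<in> sets H" and B': "B \<in> sets ?PB"
      by (simp_all add: R_def sets_gauss_PiM)
    have A_space: "A \<subseteq> space M"
      using sets.sets_into_space[OF A'] by (simp add: space_H)
    have b: "G -` B \<inter> space M \<in> sets (vimage_algebra (space M) G ?PB)"
      by (rule in_vimage_algebra[OF B'])
    have "emeasure R A * emeasure ?P B = emeasure M A * emeasure M (G -` B \<inter> space M)"
      unfolding R_def law_G[symmetric] using A_space
      by (simp add: emeasure_distr[OF id_measurable A'] emeasure_distr[OF G_measurable B'] Int_absorb2)
    also have "\<dots> = emeasure M (A \<inter> (G -` B \<inter> space M))"
      using indep_setD[OF H_indep A' b[unfolded G_def]]
      by (simp add: G_def emeasure_eq_measure flip: ennreal_mult)
    also have "A \<inter> (G -` B \<inter> space M) = (\<lambda>\<omega>. (\<omega>, G \<omega>)) -` (A \<times> B) \<inter> space M"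
      by auto
    also have "emeasure M ((\<lambda>\<omega>. (\<omega>, G \<omega>)) -` (A \<times> B) \<inter> space M) = emeasure (distr M (H \<Otimes>\<^sub>M ?PB) (\<lambda>\<omega>. (\<omega>, G \<omega>))) (A \<times> B)"
      by (rule emeasure_distr[symmetric, OF pair_measurable pair_measureI[OF A' B']])
    finally show "emeasure R A * emeasure ?P B = emeasure (distr M (H \<Otimes>\<^sub>M ?PB) (\<lambda>\<omega>. (\<omega>, G \<omega>))) (A \<times> B)" .
  qed

  define V where "V = (\<lambda>\<omega> y. gibbs_var \<gamma> E (f \<omega>) (\<mu> \<omega>) y (hermite_energy E a k (f \<omega>) y))"
  have V_G: "gibbs_var \<gamma> E (f \<omega>) (\<mu> \<omega>) (\<lambda>e. g e \<omega>) (hermite_energy E a k (f \<omega>) (\<lambda>e. g e \<omega>)) = V \<omega> (G \<omega>)" for \<omega>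
    unfolding V_def by (rule gibbs_var_hermite_energy_cong) (simp add: G_def)
  have V_measurable: "(\<lambda>(\<omega>, y). V \<omega> y) \<in> borel_measurable (H \<Otimes>\<^sub>M ?PB)"
    unfolding V_def by (rule gibbs_var_measurable)
  have V_expand: "V \<omega> (G \<omega>) = (\<Sum>e\<in>E. \<Sum>e'\<in>E. a e * a e' * (he k (G \<omega> e) * he k (G \<omega> e') * cov \<omega> e e' (G \<omega>)))"
    if "\<omega> \<in> space M" for \<omega>
    unfolding V_def using that by (intro gibbs_var_expand) (simp add: space_H)
  have "integrable M (\<lambda>\<omega>. he k (G \<omega> e) * he k (G \<omega> e') * cov \<omega> e e' (G \<omega>))" if e: "e \<in> E" "e' \<in> E" for e e'
  proof (rule integrable_mult_bounded)
    have "integrable (distr M ?PB G) (\<lambda>y. he k (y e) * he k (y e'))"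
      unfolding law_G by (rule integrable_gauss_PiM_poly_poly[OF e])
    then show "integrable M (\<lambda>\<omega>. he k (G \<omega> e) * he k (G \<omega> e'))"
      by (rule integrable_distr[OF G_measurable])
    show "(\<lambda>\<omega>. cov \<omega> e e' (G \<omega>)) \<in> borel_measurable M"
      using measurable_compose[OF pair_measurable cov_measurable[OF e]] by simp
    show "\<bar>cov \<omega> e e' (G \<omega>)\<bar> \<le> 2" if "\<omega> \<in> space M" for \<omega>
      using that e by (intro cov_bound) (simp_all add: space_H)
  qed
  then have "integrable M (\<lambda>\<omega>. \<Sum>e\<in>E. \<Sum>e'\<in>E. a e * a e' * (he k (G \<omega> e) * he k (G \<omega> e') * cov \<omega> e e' (G \<omega>)))"
    by (intro Bochner_Integration.integrable_sum integrable_mult_right)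
  then have "integrable M (\<lambda>\<omega>. V \<omega> (G \<omega>))"
    by (subst Bochner_Integration.integrable_cong[OF refl V_expand])
  then have V_integrable: "integrable (R \<Otimes>\<^sub>M ?P) (\<lambda>(\<omega>, y). V \<omega> y)"
    unfolding joint by (subst integrable_distr_eq[OF pair_measurable V_measurable]) simp
  have expectation_V: "expectation (\<lambda>\<omega>. V \<omega> (G \<omega>)) = (\<integral>\<omega>. (\<integral>y. V \<omega> y \<partial>?P) \<partial>R)"
    using RP.integral_fst'[OF V_integrable]
    unfolding joint integral_distr[OF pair_measurable V_measurable] by simp
  \<comment> \<open>\<open>R\<close> has mass one, so a bound on the inner Gaussian integral for
    almost every \<omega> carries over to the full expectation.\<close>
  have reduce: "expectation (\<lambda>\<omega>. V \<omega> (G \<omega>)) \<le> b"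
    if "AE \<omega> in R. (\<integral>y. V \<omega> y \<partial>?P) \<le> b" for b
    unfolding expectation_V using RP.integrable_fst'[OF V_integrable] that
    by (intro R.integral_le_const) simp_all
  have realization: "gibbs_realization H S E f \<mu> \<gamma> \<omega>" if "\<omega> \<in> space H" for \<omega>
    using that by unfold_locales

  have bound1: "expectation (\<lambda>\<omega>. V \<omega> (G \<omega>)) \<le> sqrt (fact k * fact (k + 1)) / \<gamma> * (\<Sum>e\<in>E. \<bar>a e\<bar>) * L2_set a E"
  proof (rule reduce, rule AE_I2)
    fix \<omega> assume "\<omega> \<in> space R"
    then interpret gibbs_realization H S E f \<mu> \<gamma> \<omega>
      by (intro realization) (simp add: space_R)
    show "(\<integral>y. V \<omega> y \<partial>?P) \<le> sqrt (fact k * fact (k + 1)) / \<gamma> * (\<Sum>e\<in>E. \<bar>a e\<bar>) * L2_set a E"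
      using integral_gibbs_var_le[of a k] \<gamma>_pos unfolding V_def by (simp add: field_simps)
  qed
  have bound2: "expectation (\<lambda>\<omega>. V \<omega> (G \<omega>))
      \<le> C * sqrt (fact (k + 1)) * \<gamma> ^ (k - 1) * (\<Sum>e\<in>E. \<bar>a e\<bar>) * L2_set a E + fact k * (L2_set a E)\<^sup>2"
    if k: "k \<ge> 1"
      and C: "AE \<omega> in M. \<forall>e\<in>E. \<bar>gibbs_deriv \<gamma> E (f \<omega>) (\<mu> \<omega>) k e (\<lambda>e'. g e' \<omega>)\<bar> \<le> C" for C :: real
  proof -
    \<comment> \<open>A negative \<open>C\<close> would make the almost sure bound on an absolute
      value false everywhere, which is impossible in a probability space with \<open>E\<close>
      nonempty.\<close>
    have "C \<ge> 0"
    proof (rule ccontr)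
      assume "\<not> C \<ge> 0"
      obtain e where "e \<in> E"
        using False by blast
      from C have "AE \<omega> in M. False"
      proof eventually_elim
        case (elim \<omega>)
        then have "\<bar>gibbs_deriv \<gamma> E (f \<omega>) (\<mu> \<omega>) k e (\<lambda>e'. g e' \<omega>)\<bar> \<le> C"
          using \<open>e \<in> E\<close> by blast
        then show ?case
          using \<open>\<not> C \<ge> 0\<close> by linarith
      qed
      then show False
        by simp
    qed
    have scale: "\<bar>avg_deriv k e \<omega> (G \<omega>)\<bar> \<le> C * \<gamma> ^ k"
      if "\<bar>gibbs_deriv \<gamma> E (f \<omega>) (\<mu> \<omega>) k e (\<lambda>e'. g e' \<omega>)\<bar> \<le> C" "e \<in> E" for e \<omega>
    proof -
      have "gibbs_deriv \<gamma> E (f \<omega>) (\<mu> \<omega>) k e (\<lambda>e'. g e' \<omega>) = gibbs_deriv \<gamma> E (f \<omega>) (\<mu> \<omega>) k e (G \<omega>)"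
        using that(2) by (intro gibbs_deriv_cong) (simp_all add: G_def)
      also have "\<dots> = avg_deriv k e \<omega> (G \<omega>) / \<gamma> ^ k"
        by (simp add: gibbs_deriv_def avg_deriv_def)
      finally show ?thesis
        using that(1) \<gamma>_pos by (simp add: abs_divide divide_le_eq)
    qed
    have "AE \<omega> in M. \<forall>e\<in>E. \<bar>avg_deriv k e \<omega> (G \<omega>)\<bar> \<le> C * \<gamma> ^ k"
      using C by eventually_elim (use scale in blast)
    \<comment> \<open>An almost sure statement about the pair can be moved to its law once the event
      is known to be measurable.\<close>
    moreover have "{x \<in> space (H \<Otimes>\<^sub>M ?PB). \<forall>e\<in>E. \<bar>avg_deriv k e (fst x) (snd x)\<bar> \<le> C * \<gamma> ^ k} \<in> sets (H \<Otimes>\<^sub>M ?PB)"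
    proof (rule sets.sets_Collect_finite_All'[OF _ finite_E False])
      fix e assume "e \<in> E"
      from avg_deriv_measurable[OF this, of k]
      have [measurable]: "(\<lambda>x. avg_deriv k e (fst x) (snd x)) \<in> borel_measurable (H \<Otimes>\<^sub>M ?PB)"
        by (simp add: split_beta')
      show "{x \<in> space (H \<Otimes>\<^sub>M ?PB). \<bar>avg_deriv k e (fst x) (snd x)\<bar> \<le> C * \<gamma> ^ k} \<in> sets (H \<Otimes>\<^sub>M ?PB)"
        by measurable
    qed
    ultimately have "AE x in R \<Otimes>\<^sub>M ?P. \<forall>e\<in>E. \<bar>avg_deriv k e (fst x) (snd x)\<bar> \<le> C * \<gamma> ^ k"
      unfolding joint by (subst AE_distr_iff[OF pair_measurable]) simp_all
    \<comment> \<open>The constant is given almost surely in all the disorder; by Fubini, for almost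
      every \<omega> it is valid for almost every Gaussian vector.\<close>
    from RP.AE_pair[OF this]
    have AE: "AE \<omega> in R. AE y in ?P. \<forall>e\<in>E. \<bar>avg_deriv k e \<omega> y\<bar> \<le> C * \<gamma> ^ k"
      by simp
    show ?thesis
    proof (rule reduce, use AE AE_space in eventually_elim)
      case (elim \<omega>)
      then interpret gibbs_realization H S E f \<mu> \<gamma> \<omega>
        by (intro realization) (simp add: space_R)
      have "\<gamma> * (\<integral>y. V \<omega> y \<partial>?P)
        \<le> (C * \<gamma> ^ k) * sqrt (fact (k + 1)) * (\<Sum>e\<in>E. \<bar>a e\<bar>) * L2_set a E + \<gamma> * (fact k * (L2_set a E)\<^sup>2)"
        unfolding V_def using elim(1) \<open>C \<ge> 0\<close> \<gamma>_pos by (intro integral_gibbs_var_le_deriv) auto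
      also have "\<dots> = \<gamma> * (C * sqrt (fact (k + 1)) * \<gamma> ^ (k - 1) * (\<Sum>e\<in>E. \<bar>a e\<bar>) * L2_set a E + fact k * (L2_set a E)\<^sup>2)"
      proof -
        \<comment> \<open>This is where \<open>k \<ge> 1\<close> enters: one factor \<gamma> is
          split off to match the one in front of the variance.\<close>
        have "\<gamma> ^ k = \<gamma> * \<gamma> ^ (k - 1)"
          using k by (cases k) auto
        then show ?thesis
          by (simp only: distrib_left ac_simps)
      qed
      finally show ?case
        using \<gamma>_pos by (simp only: mult_le_cancel_left_pos)
    qed
  qed
  show ?thesis
    unfolding V_G using bound1 bound2 by blast
qed

end
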